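(* Let $\Phi=\{f_i(x)=\lambda_i x+t_i\}_{i=1}^N$ be a self-similar IFS on $\mathbb{R}$ (with $\lambda_i\in(0,1)$, $t_i\in\mathbb{R}$) whose similarity dimension $s$, i.e. the solution of $\sum_{i=1}^N\lambda_i^s=1$, satisfies $s>1$. Let $\Theta$ be a bounded real random variable with compactly supported absolutely continuous distribution, such that for some $C>0$ and some $M\ge s$ the Fourier transform of its distribution satisfies $$|\widehat{\Theta}(x)|\le \frac{C}{(1+|x|)^M}\quad\text{for all }x\in\mathbb{R}.$$ Then, for $\mathbb{P}$-almost every $\underline{\Theta}$, the random set $\Lambda_{\underline{\Theta}}=\Pi_{\underline{\Theta}}(\Omega)$ contains a (nonempty) open interval.
   Context: $\Omega=\{1,\dots,N\}^{\mathbb{N}}$, whose elements are written $\omega=(\omega_0,\omega_1,\omega_2,\dots)$; $\Omega^*=\bigcup_{n\ge0}\{1,\dots,N\}^n$ is the set of finite words (including the empty word $\emptyset$). For $\omega\in\Omega$ and $j\ge 0$, $\omega^j=(\omega_0,\dots,\omega_{j-1})$ is the prefix of length $j$ ($\omega^0=\emptyset$). For a finite word $\omega=(\omega_0,\dots,\omega_{j-1})$, $\lambda_\omega=\prod_{i=0}^{j-1}\lambda_{\omega_i}$ (with $\lambda_\emptyset=1$). Random perturbation: $\{\Theta_\omega\}_{\omega\in\Omega^*}$ are independent copies of $\Theta$, $\underline{\Theta}=(\Theta_\omega)_{\omega\in\Omega^*}$ denotes the whole collection, and $\mathbb{P}$ is its (product) distribution. The random projection is $$\Pi_{\underline{\Theta}}(\omega)=\sum_{j=0}^\infty\lambda_{\omega^j}\,(t_{\omega_j}+\Theta_{\omega^j}),\qquad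 \omega\in\Omega.$$ The Fourier transform of the distribution of $\Theta$ is $\widehat{\Theta}(x)=\mathbb{E}(e^{ix\Theta})$. *)

theory Defs
  imports "HOL-Probability.Probability"
begin

text \<open>
  The alphabet is the set \<open>{1..N}\<close> of natural numbers. Finite words are lists, so the
  set of all of them, including the empty word, is \<^term>\<open>lists {1..N}\<close>.
\<close>

definition seqs :: "nat \<Rightarrow> (nat \<Rightarrow> nat) set" where
  "seqs N = UNIV \<rightarrow> {1..N}"

definition seq_prefix :: "(nat \<Rightarrow> nat) \<Rightarrow> nat \<Rightarrow> nat list" where
  "seq_prefix \<omega> j = map \<omega> [0..<j]"

definition word_ratio :: "(nat \<Rightarrow> real) \<Rightarrow> nat list \<Rightarrow> real" where
  "word_ratio lam w = (\<Prod>i<length w. lam (w ! i))"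

text \<open>
  \<open>\<theta> w\<close> is the perturbation attached to the word \<open>w\<close>. The series converges whenever the
  perturbations are uniformly bounded and the finitely many ratios lie in (0,1).
\<close>

definition random_proj ::
  "(nat \<Rightarrow> real) \<Rightarrow> (nat \<Rightarrow> real) \<Rightarrow> (nat list \<Rightarrow> real) \<Rightarrow> (nat \<Rightarrow> nat) \<Rightarrow> real" where
  "random_proj lam t \<theta> \<omega> =
     (\<Sum>j. word_ratio lam (seq_prefix \<omega> j) * (t (\<omega> j) + \<theta> (seq_prefix \<omega> j)))"

definition random_attractor ::
  "nat \<Rightarrow> (nat \<Rightarrow> real) \<Rightarrow> (nat \<Rightarrow> real) \<Rightarrow> (nat list \<Rightarrow> real) \<Rightarrow> real set" where
  "random_attractor N lam t \<theta> = random_proj lam t \<theta> ` seqs N"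

text \<open>
  The joint law of independent copies, one for each finite word, of a random variable
  with law \<open>\<mu>\<close>.
\<close>

definition perturbation_law :: "nat \<Rightarrow> real measure \<Rightarrow> (nat list \<Rightarrow> real) measure" where
  "perturbation_law N \<mu> = (\<Pi>\<^sub>M w\<in>lists {1..N}. \<mu>)"

definition compactly_supported :: "real measure \<Rightarrow> bool" where
  "compactly_supported \<mu> \<longleftrightarrow> (\<exists>K. compact K \<and> emeasure \<mu> (- K) = 0)"

end

theory Submission
  imports Defs "HOL-Real_Asymp.Real_Asymp"
begin

text \<open>
  The similarity dimension exceeds 1, so the cylinders of a deep level have total length far
  larger than the region they live in: they overlap heavily. The random perturbations spread
  these overlaps evenly, and a typical point is covered so often that the covering cannot die out
  anywhere in a small interval.

  To make this precise, choose a word length \<open>k\<close> and a set \<open>V\<close> of words of length \<open>k\<close> which all have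
  the same ratio \<open>r\<close>, with \<open>card V * r\<close> as large as desired. This is possible because
  \<open>\<Sum> \<lambda>\<^sub>w\<^sup>s = 1\<close> over the words of length \<open>k\<close>, while the ratios of these words take only
  polynomially many values in \<open>k\<close> (\<open>exists_many_words_of_equal_ratio\<close>). A concatenation \<open>w\<close> of \<open>n\<close>
  words from \<open>V\<close> carries an interval of radius \<open>r\<^sup>n \<epsilon>\<close> around \<open>\<Pi>(w) + r\<^sup>n x0\<close>, where \<open>\<Pi>(w)\<close> is the
  corresponding partial sum of the projection. Call \<open>w\<close> a hit for \<open>y\<close> if this interval contains \<open>y\<close>.

  The engine is \<open>supercritical_block\<close>: a hit \<open>w\<close> for \<open>y\<close> has on average at least six children \<open>w @ v\<close>
  such that even the concentric interval of half the radius contains \<open>y\<close>. By Fourier inversion, the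
  decay of the characteristic function forces the law of \<open>\<Theta>\<close> to have density at least \<open>c > 0\<close> on some
  interval. The perturbation at \<open>w\<close> itself is independent of the rest of the block and
  translates it as a whole, so each suitable child hits \<open>y\<close> with probability of order \<open>r\<close>, and there
  are of order \<open>card V\<close> of them.

  Subtrees below different words of the same length are independent of each other and of all
  perturbations at shorter words. An exponential moment computation (\<open>failure_probability\<close>) therefore shows
  that a count of \<open>2\<^sup>n\<close> hits at level \<open>n\<close> fails to double with probability at most
  \<open>exp (- 2\<^sup>n / card V)\<close>. The slack between half radius and full radius means that only the
  exponentially many points of a grid have to be controlled, so by Borel--Cantelli almost
  surely no failure occurs from some level on. At such a level the pigeonhole principle
  gives a point, hence an interval, with at least \<open>2\<^sup>n\<close> hits (\<open>many_hits_somewhere\<close>). From then on every point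
  of that interval keeps being hit (\<open>hits_persist\<close>), so it is a limit of partial sums and lies in the
  attractor, which is closed.
\<close>

section \<open>Fourier inversion and a lower bound for the density\<close>

lemma integrable_powr_decay:
  fixes M :: real
  assumes "M > 1"
  shows "integrable lborel (\<lambda>x::real. (1 + \<bar>x\<bar>) powr (- M))"
proof -
  define h where "h x = (1 + \<bar>x\<bar>) powr (- M)" for x :: real
  have "(\<lambda>x. x powr (- M)) integrable_on {1..}"
    using has_integral_powr_to_inf[of "- M" 1] assms by (auto simp: integrable_on_def)
  then have "(\<lambda>x. x powr (- M)) absolutely_integrable_on {1..}"
    by (intro nonnegative_absolutely_integrable_1) auto
  then have "integrable lborel (\<lambda>x. indicator {1..} x * x powr (- M))"
    unfolding set_integrable_def
    by (subst (asm) integrable_completion) auto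
  then have "integrable lborel (\<lambda>x. indicator {1..} (1 + 1 * x) * (1 + 1 * x) powr (- M))"
    by (rule lborel_integrable_real_affine) auto
  then have pos: "integrable lborel (\<lambda>x. indicator {0..} x * h x)"
    by (rule Bochner_Integration.integrable_bound) (auto simp: h_def indicator_def)
  then have "integrable lborel (\<lambda>x. indicator {0..} (0 + (-1) * x) * h (0 + (-1) * x))"
    by (rule lborel_integrable_real_affine) auto
  with pos have "integrable lborel
      (\<lambda>x. indicator {0..} x * h x + indicator {0..} (0 + (-1) * x) * h (0 + (-1) * x))"
    by (rule Bochner_Integration.integrable_add)
  then show ?thesis
    unfolding h_def[symmetric]
    by (rule Bochner_Integration.integrable_bound) (auto simp: h_def indicator_def)
qed

text \<open>
  The kernel of the Levy inversion formula is the integral of \<open>iexp (-(t * y))\<close> over \<open>y\<close> in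
  \<open>[a, b]\<close>, so replacing the integrand by its value at a nearby point \<open>p\<close> costs at most the length
  of the interval times the oscillation of the integrand.
\<close>

lemma Levy_kernel_approx:
  fixes a b p q t :: real
  assumes "p \<le> a" "a \<le> b" "b \<le> q" "t \<noteq> 0"
  shows "cmod ((iexp (-(t * a)) - iexp (-(t * b))) / (\<i> * t) - (b - a) * iexp (-(t * p)))
           \<le> (b - a) * min 2 (\<bar>t\<bar> * (q - p))"
proof -
  define h where "h y = - iexp (-(t * y)) / (\<i> * t) - y * iexp (-(t * p))" for y :: real
  have hd: "(h has_vector_derivative (iexp (-(t * y)) - iexp (-(t * p)))) (at y within {a..b})" for y
  proof -
    have "((\<lambda>z. - exp (- (\<i> * t * z)) / (\<i> * t) - z * iexp (-(t * p))) has_field_derivative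
        (exp (- (\<i> * t * of_real y)) - iexp (-(t * p)))) (at (of_real y))"
      using \<open>t \<noteq> 0\<close> by (auto intro!: derivative_eq_intros simp: field_simps)
    from has_vector_derivative_real_field[OF this, of "{a..b}"] show ?thesis
      by (simp add: h_def[abs_def] mult.assoc)
  qed
  have bd: "norm (iexp (-(t * y)) - iexp (-(t * p))) \<le> min 2 (\<bar>t\<bar> * (q - p))" if "y \<in> {a..b}" for y
  proof -
    have "norm (iexp (-(t * y)) - iexp (-(t * p))) \<le> 2"
      using norm_triangle_ineq4[of "iexp (-(t * y))" "iexp (-(t * p))"] by simp
    moreover have "norm (iexp (-(t * y)) - iexp (-(t * p))) =
        norm (iexp (-(t * p)) * (iexp (-(t * (y - p))) - 1))"
      by (simp add: algebra_simps flip: exp_add)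
    moreover have "\<dots> = norm (iexp (-(t * (y - p))) - 1)"
      unfolding norm_mult by simp
    moreover have "\<dots> \<le> \<bar>t * (y - p)\<bar>"
      using iexp_approx1[of "-(t * (y - p))" 0] by simp
    moreover have "\<bar>t * (y - p)\<bar> \<le> \<bar>t\<bar> * (q - p)"
      using that assms by (auto simp: abs_mult intro!: mult_left_mono)
    ultimately show ?thesis by simp
  qed
  have "norm (h b - h a) \<le> min 2 (\<bar>t\<bar> * (q - p)) * norm (b - a)"
  proof (rule differentiable_bound[where S = "{a..b}"
        and f' = "\<lambda>y x. x *\<^sub>R (iexp (-(t * y)) - iexp (-(t * p)))"])
    show "(h has_derivative (\<lambda>x. x *\<^sub>R (iexp (-(t * y)) - iexp (-(t * p))))) (at y within {a..b})" for y
      using hd[of y] by (simp add: has_vector_derivative_def)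
    show "onorm (\<lambda>x. x *\<^sub>R (iexp (-(t * y)) - iexp (-(t * p)))) \<le> min 2 (\<bar>t\<bar> * (q - p))"
      if "y \<in> {a..b}" for y
    proof (rule onorm_le)
      fix x :: real
      have "\<bar>x\<bar> * norm (iexp (-(t * y)) - iexp (-(t * p))) \<le> \<bar>x\<bar> * min 2 (\<bar>t\<bar> * (q - p))"
        by (rule mult_left_mono[OF bd[OF that]]) simp
      then show "norm (x *\<^sub>R (iexp (-(t * y)) - iexp (-(t * p)))) \<le> min 2 (\<bar>t\<bar> * (q - p)) * norm x"
        unfolding norm_scaleR real_norm_def by (subst (2) mult.commute)
    qed
  qed (use assms in auto)
  moreover have "h b - h a = (iexp (-(t * a)) - iexp (-(t * b))) / (\<i> * t) - (b - a) * iexp (-(t * p))"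
    using \<open>t \<noteq> 0\<close> by (simp add: h_def field_simps)
  ultimately show ?thesis
    using assms by (simp add: mult.commute)
qed

text \<open>
  An integrable characteristic function dominates the truncated integrals of the inversion
  theorem, so the limit may be taken under the integral sign.
\<close>

lemma (in real_distribution) Levy_inversion_integrable:
  fixes a b :: real
  assumes ab: "a \<le> b" "measure M {a} = 0" "measure M {b} = 0"
    and int: "integrable lborel (\<lambda>t. cmod (char M t))"
  shows "complex_of_real (measure M {a<..b}) =
    1 / (2 * pi) * (CLBINT t. (iexp (-(t * a)) - iexp (-(t * b))) / (\<i> * t) * char M t)"
proof -
  let ?F = "\<lambda>t. (iexp (-(t * a)) - iexp (-(t * b))) / (\<i> * t) * char M t"
  have bd: "cmod (?F t) \<le> (b - a) * cmod (char M t)" for t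
  proof (cases "t = 0")
    case False
    then have "cmod ((iexp (-(t * a)) - iexp (-(t * b))) / (\<i> * t)) \<le> b - a"
      using Levy_Inversion_aux2[of "-b" "-a" t] ab by simp
    then show ?thesis
      unfolding norm_mult by (rule mult_right_mono) simp
  qed (use ab in auto)
  let ?c = "complex_of_real (1 / (2 * pi))"
  have cut: "(CLBINT t=-real n..real n. ?F t) = (CLBINT t. indicator {-real n<..<real n} t *\<^sub>R ?F t)" for n
    by (simp add: interval_lebesgue_integral_def set_lebesgue_integral_def)
  have "(\<lambda>n. CLBINT t. indicator {-real n<..<real n} t *\<^sub>R ?F t) \<longlonglongrightarrow> (CLBINT t. ?F t)"
  proof (rule integral_dominated_convergence[where w = "\<lambda>t. (b - a) * cmod (char M t)"])
    show "AE t in lborel. (\<lambda>n. indicator {-real n<..<real n} t *\<^sub>R ?F t) \<longlonglongrightarrow> ?F t"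
    proof (intro AE_I2 tendsto_eventually)
      fix t :: real
      obtain m :: nat where m: "\<bar>t\<bar> < m" using reals_Archimedean2 by blast
      show "\<forall>\<^sub>F n in sequentially. indicator {-real n<..<real n} t *\<^sub>R ?F t = ?F t"
        using eventually_ge_at_top[of m] by eventually_elim (use m in \<open>auto simp: indicator_def\<close>)
    qed
    show "AE t in lborel. norm (indicator {-real n<..<real n} t *\<^sub>R ?F t) \<le> (b - a) * cmod (char M t)" for n
    proof (rule AE_I2)
      fix t
      show "norm (indicator {-real n<..<real n} t *\<^sub>R ?F t) \<le> (b - a) * cmod (char M t)"
        using bd[of t] ab by (cases "t \<in> {-real n<..<real n}") auto
    qed
  qed (use int in auto)
  then have "(\<lambda>n. ?c * (CLBINT t=-real n..real n. ?F t)) \<longlonglongrightarrow> ?c * (CLBINT t. ?F t)"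
    unfolding cut by (rule tendsto_mult_left)
  moreover have "(\<lambda>n. ?c * (CLBINT t=-real n..real n. ?F t)) \<longlonglongrightarrow> measure M {a<..b}"
    using Levy_Inversion[OF ab] by simp
  ultimately have "complex_of_real (measure M {a<..b}) = ?c * (CLBINT t. ?F t)"
    by (rule LIMSEQ_unique[rotated])
  then show ?thesis .
qed

text \<open>
  Pigeonhole on the increments of a distribution function \<open>F\<close>: among \<open>n\<close> cells of equal length
  that divide \<open>[-R, R]\<close>, one carries at least the average share of the mass.
\<close>

lemma exists_crowded_cell:
  fixes F :: "real \<Rightarrow> real"
  assumes "R > 0" "n > 0" "F R - F (- R) \<ge> 1 / 2"
  shows "\<exists>p. F (p + 2 * R / real n) - F p \<ge> (2 * R / real n) / (4 * R)"
proof (rule ccontr)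
  assume "\<not> ?thesis"
  define d where "d = 2 * R / real n"
  have "d / (4 * R) = 1 / (2 * real n)"
    using assms by (simp add: d_def)
  with \<open>\<not> ?thesis\<close> have less: "F (p + d) - F p < 1 / (2 * real n)" for p
    by (auto simp: not_le d_def)
  define G where "G i = F (- R + real i * d)" for i
  have "1 / 2 \<le> G n - G 0"
    using assms by (simp add: G_def d_def)
  also have "\<dots> = (\<Sum>i<n. G (Suc i) - G i)"
    by (simp add: sum_lessThan_telescope)
  also have "\<dots> < (\<Sum>i<n. 1 / (2 * real n))"
  proof (rule sum_strict_mono)
    show "G (Suc i) - G i < 1 / (2 * real n)" for i
      using less[of "- R + real i * d"] by (simp add: G_def distrib_right add_ac)
  qed (use assms in auto)
  finally show False using assms by simp
qed

text \<open>
  An integrable characteristic function makes the difference quotients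
  \<open>measure M {a<..b} / (b - a)\<close> vary little inside short intervals, uniformly in the location.
  On a short interval that carries at least its average share of mass, all of these
  quotients are therefore bounded below.
\<close>

lemma (in real_distribution) density_bounded_below_on_interval:
  fixes C D :: real
  assumes atomless: "\<And>x. measure M {x} = 0"
    and D: "D > 1"
    and decay: "\<And>x. cmod (char M x) \<le> C / (1 + \<bar>x\<bar>) powr D"
  shows "\<exists>c p q. 0 < c \<and> p < q \<and>
           (\<forall>a b. p \<le> a \<and> a \<le> b \<and> b \<le> q \<longrightarrow> c * (b - a) \<le> measure M {a<..b})"
proof -
  define \<phi> where "\<phi> t = cmod (char M t)" for t
  have [measurable]: "\<phi> \<in> borel_measurable borel"
    unfolding \<phi>_def by measurable
  have \<phi>0: "\<phi> t \<ge> 0" for t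
    by (simp add: \<phi>_def)
  have int: "integrable lborel \<phi>"
  proof (rule Bochner_Integration.integrable_bound)
    show "integrable lborel (\<lambda>x. C * (1 + \<bar>x\<bar>) powr (- D))"
      using integrable_powr_decay[OF D] by simp
    show "AE x in lborel. norm (\<phi> x) \<le> norm (C * (1 + \<bar>x\<bar>) powr (- D))"
    proof (rule AE_I2)
      fix x
      have "norm (\<phi> x) \<le> C * (1 + \<bar>x\<bar>) powr (- D)"
        using decay[of x] by (simp add: \<phi>_def powr_minus_divide)
      then show "norm (\<phi> x) \<le> norm (C * (1 + \<bar>x\<bar>) powr (- D))"
        using order_trans abs_ge_self unfolding real_norm_def by blast
    qed
  qed simp
  \<comment> \<open>\<open>\<omega> d\<close> bounds the oscillation of \<open>2 * pi\<close> times the difference quotients inside an interval of length \<open>d\<close>.\<close>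
  define \<omega> where "\<omega> d = (LBINT t. min 2 (\<bar>t\<bar> * d) * \<phi> t)" for d :: real
  have int\<omega>: "integrable lborel (\<lambda>t. min 2 (\<bar>t\<bar> * d) * \<phi> t)" if "d \<ge> 0" for d
    by (rule Bochner_Integration.integrable_bound[where f = "\<lambda>t. 2 * \<phi> t"])
      (use int that \<phi>0 in \<open>auto simp: abs_mult intro!: mult_right_mono\<close>)
  have osc: "\<bar>2 * pi * measure M {a<..b} - (b - a) * Re (CLBINT t. iexp (-(t * p)) * char M t)\<bar>
               \<le> (b - a) * \<omega> (q - p)" if "p \<le> a" "a \<le> b" "b \<le> q" for a b p q
  proof -
    let ?K = "\<lambda>t. (iexp (-(t * a)) - iexp (-(t * b))) / (\<i> * t)"
    let ?e = "\<lambda>t. iexp (-(t * p)) * char M t"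
    have inte: "complex_integrable lborel ?e"
      by (rule Bochner_Integration.integrable_bound[OF int]) (auto simp: \<phi>_def norm_mult)
    have bd: "cmod (?K t * char M t - (b - a) * ?e t) \<le> (b - a) * (min 2 (\<bar>t\<bar> * (q - p)) * \<phi> t)"
      if "t \<noteq> 0" for t
    proof -
      have "?K t * char M t - (b - a) * ?e t = (?K t - (b - a) * iexp (-(t * p))) * char M t"
        by (simp add: algebra_simps)
      also have "cmod \<dots> \<le> ((b - a) * min 2 (\<bar>t\<bar> * (q - p))) * \<phi> t"
        unfolding norm_mult[of _ "char M t"] \<phi>_def
        by (rule mult_right_mono[OF Levy_kernel_approx]) (use \<open>p \<le> a\<close> \<open>a \<le> b\<close> \<open>b \<le> q\<close> that in auto)
      finally show ?thesis by (simp add: mult.assoc)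
    qed
    have ae: "AE t in lborel. t \<noteq> (0::real)"
      by (rule AE_lborel_singleton)
    have intd: "complex_integrable lborel (\<lambda>t. ?K t * char M t - (b - a) * ?e t)"
    proof (rule Bochner_Integration.integrable_bound)
      show "integrable lborel (\<lambda>t. (b - a) * (min 2 (\<bar>t\<bar> * (q - p)) * \<phi> t))"
        using int\<omega>[of "q - p"] that by auto
      show "AE t in lborel. cmod (?K t * char M t - (b - a) * ?e t)
              \<le> norm ((b - a) * (min 2 (\<bar>t\<bar> * (q - p)) * \<phi> t))"
        using ae
      proof eventually_elim
        case (elim t)
        show ?case using bd[OF elim] order_trans[OF _ abs_ge_self] unfolding real_norm_def by blast
      qed
    qed simp
    have "complex_integrable lborel (\<lambda>t. (?K t * char M t - (b - a) * ?e t) + (b - a) * ?e t)"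
      by (rule Bochner_Integration.integrable_add[OF intd]) (use inte in simp)
    then have intK: "complex_integrable lborel (\<lambda>t. ?K t * char M t)"
      by simp
    have "2 * pi * complex_of_real (measure M {a<..b}) = (CLBINT t. ?K t * char M t)"
      using Levy_inversion_integrable[OF that(2) atomless atomless int[unfolded \<phi>_def[abs_def]]]
      by simp
    then have "cmod (2 * pi * complex_of_real (measure M {a<..b}) - (b - a) * (CLBINT t. ?e t))
        = cmod (CLBINT t. ?K t * char M t - (b - a) * ?e t)"
      using intK inte by simp
    also have "\<dots> \<le> (LBINT t. cmod (?K t * char M t - (b - a) * ?e t))"
      by (rule integral_norm_bound)
    also have "\<dots> \<le> (LBINT t. (b - a) * (min 2 (\<bar>t\<bar> * (q - p)) * \<phi> t))"
    proof (rule integral_mono_AE)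
      show "integrable lborel (\<lambda>t. cmod (?K t * char M t - (b - a) * ?e t))"
        by (rule integrable_norm[OF intd])
      show "integrable lborel (\<lambda>t. (b - a) * (min 2 (\<bar>t\<bar> * (q - p)) * \<phi> t))"
        using int\<omega>[of "q - p"] that by auto
      show "AE t in lborel. cmod (?K t * char M t - (b - a) * ?e t)
              \<le> (b - a) * (min 2 (\<bar>t\<bar> * (q - p)) * \<phi> t)"
        using ae by eventually_elim (rule bd)
    qed
    also have "\<dots> = (b - a) * \<omega> (q - p)"
      by (simp add: \<omega>_def)
    finally show ?thesis
      using abs_Re_le_cmod[of "2 * pi * complex_of_real (measure M {a<..b}) - (b - a) * (CLBINT t. ?e t)"]
      by simp
  qed
  have \<omega>0: "(\<lambda>n. \<omega> (2 * R / real n)) \<longlonglongrightarrow> 0" if R: "R > 0" for R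
  proof -
    have "(\<lambda>n. \<omega> (2 * R / real n)) \<longlonglongrightarrow> integral\<^sup>L lborel (\<lambda>t::real. 0::real)"
      unfolding \<omega>_def
    proof (rule integral_dominated_convergence[where w = "\<lambda>t. 2 * \<phi> t" and f = "\<lambda>t. 0"])
      show "AE t in lborel. (\<lambda>n. min 2 (\<bar>t\<bar> * (2 * R / real n)) * \<phi> t) \<longlonglongrightarrow> 0"
        by (rule AE_I2) (auto intro!: tendsto_eq_intros lim_const_over_n)
      show "AE t in lborel. norm (min 2 (\<bar>t\<bar> * (2 * R / real n)) * \<phi> t) \<le> 2 * \<phi> t" for n
        using \<phi>0 R by (intro AE_I2) (auto simp: abs_mult intro!: mult_right_mono)
    qed (use int in auto)
    then show ?thesis by simp
  qed
  have "((\<lambda>R. cdf M R - cdf M (- R)) \<longlongrightarrow> 1 - 0) at_top"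
    by (intro tendsto_diff cdf_lim_at_top_prob
        filterlim_compose[OF cdf_lim_at_bot filterlim_uminus_at_bot_at_top])
  then have "\<forall>\<^sub>F R in at_top. cdf M R - cdf M (- R) > 1 / 2"
    by (rule order_tendstoD) simp
  then have "\<forall>\<^sub>F R in at_top. cdf M R - cdf M (- R) > 1 / 2 \<and> R > 0"
    using eventually_gt_at_top by (rule eventually_conj)
  from eventually_happens'[OF trivial_limit_at_top_linorder this]
  obtain R where R: "cdf M R - cdf M (- R) > 1 / 2" "R > 0"
    by blast
  \<comment> \<open>A cell with its average share of the mass \<open>1 / 2\<close> on \<open>[-R, R]\<close> has quotient at least \<open>e\<close>. If the
    oscillation is below \<open>e\<close>, then the quotients of all subintervals, multiplied by \<open>2 * pi\<close>, are at least
    \<open>2 * pi * e - 2 * e \<ge> pi * e\<close>.\<close>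
  define e where "e = 1 / (4 * R)"
  have e: "e > 0" using R by (simp add: e_def)
  have "\<forall>\<^sub>F n in sequentially. \<omega> (2 * R / real n) < e \<and> n > 0"
    using \<omega>0[OF R(2)] e by (intro eventually_conj order_tendstoD eventually_gt_at_top)
  then obtain n where n: "\<omega> (2 * R / real n) < e" "n > 0"
    using eventually_happens'[OF sequentially_bot] by blast
  obtain p where p: "cdf M (p + 2 * R / real n) - cdf M p \<ge> (2 * R / real n) * e"
    using exists_crowded_cell[OF R(2) n(2) less_imp_le[OF R(1)]] by (auto simp: e_def)
  define d where "d = 2 * R / real n"
  have d: "d > 0" using R n by (simp add: d_def)
  define f where "f = Re (CLBINT t. iexp (-(t * p)) * char M t)"
  have "measure M {p<..p + d} \<ge> d * e"
    using p d cdf_diff_eq[of p "p + d"] by (simp add: d_def)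
  moreover have "\<bar>2 * pi * measure M {p<..p + d} - d * f\<bar> \<le> d * \<omega> d"
    using osc[of p p "p + d" "p + d"] d by (simp add: f_def)
  moreover have "2 * pi * (d * e) \<le> 2 * pi * measure M {p<..p + d}"
    by (rule mult_left_mono) (use calculation in auto)
  ultimately have "2 * pi * (d * e) \<le> d * f + d * \<omega> d"
    by linarith
  then have "d * (2 * pi * e) \<le> d * (f + \<omega> d)"
    by (simp only: distrib_left mult.left_commute mult.assoc)
  then have f: "2 * pi * e \<le> f + \<omega> d"
    using d by (rule mult_left_le_imp_le)
  have "e / 2 * (b - a) \<le> measure M {a<..b}" if ab: "p \<le> a" "a \<le> b" "b \<le> p + d" for a b
  proof -
    have "pi * e \<ge> 2 * e"
      using e pi_ge_two by (intro mult_right_mono) auto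
    with f n(1) have "pi * e \<le> f - \<omega> d"
      by (simp add: d_def)
    then have "(b - a) * (pi * e) \<le> (b - a) * (f - \<omega> d)"
      using ab by (intro mult_left_mono) auto
    also have "\<dots> = (b - a) * f - (b - a) * \<omega> d"
      by (rule right_diff_distrib)
    also have "\<dots> \<le> 2 * pi * measure M {a<..b}"
      using osc[OF ab] unfolding f_def[symmetric] add_diff_cancel_left' by linarith
    finally have "pi * (e * (b - a)) \<le> pi * (2 * measure M {a<..b})"
      by (simp only: mult_ac)
    then have "e * (b - a) \<le> 2 * measure M {a<..b}"
      using pi_gt_zero by (rule mult_left_le_imp_le)
    then show ?thesis by simp
  qed
  moreover have "e / 2 > 0" "p < p + d"
    using e d by auto
  ultimately show ?thesis
    by blast
qed

section \<open>Words with a common contraction ratio\<close>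

lemma word_ratio_Nil [simp]: "word_ratio lam [] = 1"
  by (simp add: word_ratio_def)

lemma word_ratio_Cons: "word_ratio lam (i # w) = lam i * word_ratio lam w"
  by (simp add: word_ratio_def prod.lessThan_Suc_shift del: prod.lessThan_Suc)

lemma word_ratio_append: "word_ratio lam (w @ v) = word_ratio lam w * word_ratio lam v"
  by (induction w) (simp_all add: word_ratio_Cons)

text \<open>
  The ratio of a word depends only on its letter counts. This is what bounds the number of
  different ratios.
\<close>

lemma word_ratio_eq_prod_count:
  assumes "w \<in> lists A" "finite A"
  shows "word_ratio lam w = (\<Prod>i\<in>A. lam i ^ count_list w i)"
  using assms(1)
proof (induction w)
  case (Cons a w)
  have "(\<Prod>i\<in>A. lam i ^ count_list (a # w) i) = (\<Prod>i\<in>A. (if a = i then lam i else 1) * lam i ^ count_list w i)"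
    by (intro prod.cong) auto
  also have "\<dots> = lam a * word_ratio lam w"
    using Cons assms(2) by (simp add: prod.distrib)
  finally show ?case by (simp add: word_ratio_Cons)
qed simp

definition words :: "nat \<Rightarrow> nat \<Rightarrow> nat list set" where
  "words N k = {w \<in> lists {1..N}. length w = k}"

lemma finite_words [simp]: "finite (words N k)"
proof -
  have "words N k = {w. set w \<subseteq> {1..N} \<and> length w = k}"
    by (auto simp: words_def lists_eq_set)
  then show ?thesis by (simp add: finite_lists_length_eq)
qed

lemma words_0 [simp]: "words N 0 = {[]}"
  by (auto simp: words_def)

lemma append_mem_words: "w \<in> words N a \<Longrightarrow> v \<in> words N b \<Longrightarrow> w @ v \<in> words N (a + b)"
  by (auto simp: words_def)

lemma words_Suc: "words N (Suc k) = (\<lambda>(i, w). i # w) ` ({1..N} \<times> words N k)"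
  by (fastforce simp: words_def length_Suc_conv image_iff)

lemma word_ratio_pos:
  assumes "\<And>i. i \<in> {1..N} \<Longrightarrow> 0 < lam i" "w \<in> lists {1..N}"
  shows "0 < word_ratio lam w"
  using assms(2) by (induction w) (auto simp: word_ratio_Cons assms(1))

lemma word_ratio_le_power:
  assumes "\<And>i. i \<in> {1..N} \<Longrightarrow> 0 < lam i \<and> lam i \<le> m" "w \<in> lists {1..N}"
  shows "word_ratio lam w \<le> m ^ length w"
  using assms(2)
proof (induction w)
  case (Cons a w)
  have "0 < word_ratio lam w"
    using Cons assms(1) by (intro word_ratio_pos[of N]) auto
  moreover have "0 < lam a" "lam a \<le> m"
    using Cons assms(1)[of a] by auto
  ultimately show ?case
    using Cons by (auto simp: word_ratio_Cons intro!: mult_mono)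
qed simp

lemma sum_words_ratio_powr:
  assumes "\<And>i. i \<in> {1..N} \<Longrightarrow> 0 < lam i"
    and "(\<Sum>i=1..N. lam i powr s) = 1"
  shows "(\<Sum>w\<in>words N k. word_ratio lam w powr s) = 1"
proof (induction k)
  case (Suc k)
  have "(\<Sum>w\<in>words N (Suc k). word_ratio lam w powr s)
      = (\<Sum>(i, w)\<in>{1..N} \<times> words N k. word_ratio lam (i # w) powr s)"
    unfolding words_Suc by (subst sum.reindex) (auto intro!: inj_onI simp: case_prod_beta)
  also have "\<dots> = (\<Sum>i=1..N. \<Sum>w\<in>words N k. lam i powr s * word_ratio lam w powr s)"
    unfolding sum.cartesian_product[symmetric]
  proof (intro sum.cong refl)
    fix i w assume "i \<in> {1..N}" "w \<in> words N k"
    then have "0 < lam i" "0 < word_ratio lam w"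
      using assms(1) by (auto intro!: word_ratio_pos[of N] simp: words_def)
    then show "word_ratio lam (i # w) powr s = lam i powr s * word_ratio lam w powr s"
      by (simp add: word_ratio_Cons powr_mult)
  qed
  also have "\<dots> = 1"
    using Suc assms(2) by (simp flip: sum_distrib_left)
  finally show ?case .
qed simp

text \<open>
  Each of the \<open>N\<close> letter counts of a word of length \<open>k\<close> lies in \<open>{0..k}\<close>.
\<close>

lemma card_word_ratios_le:
  "card (word_ratio lam ` words N k) \<le> (k + 1) ^ N"
proof -
  let ?T = "\<Pi>\<^sub>E i\<in>{1..N}. {..k}"
  have "word_ratio lam ` words N k \<subseteq> (\<lambda>c. \<Prod>i=1..N. lam i ^ c i) ` ?T"
  proof
    fix r assume "r \<in> word_ratio lam ` words N k"
    then obtain w where w: "w \<in> lists {1..N}" "length w = k" "r = word_ratio lam w"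
      by (auto simp: words_def)
    have "r = (\<Prod>i=1..N. lam i ^ (\<lambda>i\<in>{1..N}. count_list w i) i)"
      using word_ratio_eq_prod_count[OF w(1)] w(3) by simp
    moreover have "(\<lambda>i\<in>{1..N}. count_list w i) \<in> ?T"
      using count_le_length[of w] w(2) by auto
    ultimately show "r \<in> (\<lambda>c. \<Prod>i=1..N. lam i ^ c i) ` ?T"
      by blast
  qed
  then have "card (word_ratio lam ` words N k) \<le> card ?T"
    by (rule surj_card_le[rotated]) (auto intro: finite_PiE)
  also have "\<dots> = (k + 1) ^ N"
    by (simp add: card_PiE)
  finally show ?thesis .
qed

text \<open>
  The words of length \<open>k\<close> have total weight \<open>\<Sum> \<lambda>\<^sub>w\<^sup>s = 1\<close>, distributed over at most \<open>(k + 1)\<^sup>N\<close>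
  ratio classes, so some class \<open>V\<close> with ratio \<open>r\<close> has \<open>card V * r\<^sup>s \<ge> 1 / (k + 1)\<^sup>N\<close>. Multiplying
  by \<open>r\<^bsup>1 - s\<^esup>\<close>, which grows exponentially in \<open>k\<close> because \<open>s > 1\<close>, beats the polynomial loss.
\<close>

lemma exists_many_words_of_equal_ratio:
  assumes lam: "\<And>i. i \<in> {1..N} \<Longrightarrow> 0 < lam i \<and> lam i < 1"
    and dim: "(\<Sum>i=1..N. lam i powr s) = 1" and s: "s > 1"
    and \<rho>: "\<rho> > 0"
  shows "\<exists>k V r. 0 < k \<and> V \<subseteq> words N k \<and> (\<forall>v\<in>V. word_ratio lam v = r) \<and>
           0 < r \<and> r < \<rho> \<and> K \<le> real (card V) * r"
proof -
  define m where "m = Max (lam ` {1..N})"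
  have N: "{1..N} \<noteq> {}"
    using dim by (metis sum.empty zero_neq_one)
  have m: "0 < m" "m < 1"
    using N lam by (auto simp: m_def Max_gr_iff)
  have le_m: "lam i \<le> m" if "i \<in> {1..N}" for i
    using that by (auto simp: m_def)
  have ratio: "0 < word_ratio lam w" "word_ratio lam w \<le> m ^ k" if "w \<in> words N k" for w k
    using that word_ratio_pos[of N lam w] word_ratio_le_power[of N lam m w] lam le_m
    by (auto simp: words_def)
  define b where "b = m powr (1 - s)"
  have b: "b > 1"
    using m s by (simp add: b_def powr_def mult_neg_neg)
  have "(\<lambda>k. real (k + 1) ^ N * \<bar>K\<bar> / b ^ k) \<longlonglongrightarrow> 0"
    using b by real_asymp
  moreover have "(\<lambda>k. m ^ k) \<longlonglongrightarrow> 0"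
    using m by real_asymp
  ultimately have "\<forall>\<^sub>F k in sequentially. real (k + 1) ^ N * \<bar>K\<bar> / b ^ k < 1 \<and> m ^ k < \<rho> \<and> 0 < k"
    using \<rho> by (intro eventually_conj order_tendstoD eventually_gt_at_top) auto
  from eventually_happens'[OF sequentially_bot this]
  obtain k where k: "real (k + 1) ^ N * \<bar>K\<bar> / b ^ k < 1" "m ^ k < \<rho>" "0 < k"
    by blast
  define R where "R = word_ratio lam ` words N k"
  define V where "V r = {w \<in> words N k. word_ratio lam w = r}" for r
  have "(\<Sum>r\<in>R. real (card (V r)) * r powr s) = (\<Sum>r\<in>R. \<Sum>w\<in>V r. word_ratio lam w powr s)"
    by (intro sum.cong) (auto simp: V_def)
  also have "\<dots> = (\<Sum>w\<in>words N k. word_ratio lam w powr s)"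
    unfolding V_def by (rule sum.group) (auto simp: R_def)
  also have "\<dots> = 1"
    using sum_words_ratio_powr[OF _ dim] lam by auto
  finally have total: "(\<Sum>r\<in>R. real (card (V r)) * r powr s) = 1" .
  have R: "finite R" "R \<noteq> {}"
    using total by (auto simp: R_def)
  obtain r where r: "r \<in> R" "real (card (V r)) * r powr s \<ge> 1 / real (card R)"
  proof (rule ccontr)
    assume "\<not> thesis"
    with that have "real (card (V r)) * r powr s < 1 / real (card R)" if "r \<in> R" for r
      using \<open>r \<in> R\<close> by force
    then have "(\<Sum>r\<in>R. real (card (V r)) * r powr s) < (\<Sum>r\<in>R. 1 / real (card R))"
      using R by (intro sum_strict_mono) auto
    with total R show False by simp
  qed
  have rpos: "0 < r" "r \<le> m ^ k"
    using r(1) ratio by (auto simp: R_def)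
  have "K \<le> \<bar>K\<bar>" by simp
  also have "\<bar>K\<bar> \<le> 1 / real (k + 1) ^ N * b ^ k"
    using k(1) b by (simp add: field_simps)
  also have "\<dots> \<le> 1 / real (card R) * b ^ k"
  proof -
    have "real (card R) \<le> real (k + 1) ^ N"
      using card_word_ratios_le[of lam N k] unfolding R_def
      by (metis of_nat_le_iff of_nat_power)
    moreover have "card R > 0" using R by (simp add: card_gt_0_iff)
    ultimately show ?thesis
      using b by (intro mult_right_mono divide_left_mono) auto
  qed
  also have "\<dots> \<le> (real (card (V r)) * r powr s) * r powr (1 - s)"
  proof (intro mult_mono r(2))
    have "b ^ k = (m ^ k) powr (1 - s)"
      using m by (simp add: b_def powr_powr mult.commute flip: powr_realpow)
    also have "\<dots> \<le> r powr (1 - s)"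
      using rpos s by (intro powr_mono2') auto
    finally show "b ^ k \<le> r powr (1 - s)" .
  qed (use b in auto)
  also have "\<dots> = real (card (V r)) * r"
    using rpos by (simp add: mult.assoc flip: powr_add)
  finally have "K \<le> real (card (V r)) * r" .
  with k rpos show ?thesis
    by (intro exI[of _ k] exI[of _ "V r"] exI[of _ r]) (auto simp: V_def)
qed

section \<open>Partial sums of the projection\<close>

definition partial_proj ::
  "(nat \<Rightarrow> real) \<Rightarrow> (nat \<Rightarrow> real) \<Rightarrow> (nat list \<Rightarrow> real) \<Rightarrow> nat list \<Rightarrow> real" where
  "partial_proj lam t \<theta> w =
     (\<Sum>j<length w. word_ratio lam (take j w) * (t (w ! j) + \<theta> (take j w)))"

lemma partial_proj_Nil [simp]: "partial_proj lam t \<theta> [] = 0"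
  by (simp add: partial_proj_def)

lemma partial_proj_snoc:
  "partial_proj lam t \<theta> (w @ [i]) = partial_proj lam t \<theta> w + word_ratio lam w * (t i + \<theta> w)"
  by (simp add: partial_proj_def nth_append)

text \<open>
  Self-similarity: below a word \<open>w\<close>, the construction is a scaled and translated copy of itself
  driven by the perturbations of the subtree at \<open>w\<close>.
\<close>

lemma partial_proj_append:
  "partial_proj lam t \<theta> (w @ v) =
     partial_proj lam t \<theta> w + word_ratio lam w * partial_proj lam t (\<lambda>u. \<theta> (w @ u)) v"
proof (induction v rule: rev_induct)
  case (snoc i v)
  have "partial_proj lam t \<theta> (w @ v @ [i]) =
      partial_proj lam t \<theta> (w @ v) + word_ratio lam (w @ v) * (t i + \<theta> (w @ v))"
    using partial_proj_snoc[of lam t \<theta> "w @ v" i] by simp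
  with snoc show ?case
    by (simp add: partial_proj_snoc word_ratio_append algebra_simps)
qed simp

lemma partial_proj_cong:
  assumes "\<And>j. j < length w \<Longrightarrow> \<theta> (take j w) = \<theta>' (take j w)"
  shows "partial_proj lam t \<theta> w = partial_proj lam t \<theta>' w"
  using assms by (simp add: partial_proj_def)

lemma seq_prefix_simps [simp]:
  "length (seq_prefix \<omega> n) = n" "seq_prefix \<omega> 0 = []"
  "seq_prefix \<omega> (Suc n) = seq_prefix \<omega> n @ [\<omega> n]"
  by (auto simp: seq_prefix_def)

lemma seq_prefix_in_lists: "\<omega> \<in> seqs N \<Longrightarrow> seq_prefix \<omega> n \<in> lists {1..N}"
  by (force simp: seqs_def seq_prefix_def Pi_iff)

lemma partial_proj_seq_prefix:
  "partial_proj lam t \<theta> (seq_prefix \<omega> n) =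
     (\<Sum>j<n. word_ratio lam (seq_prefix \<omega> j) * (t (\<omega> j) + \<theta> (seq_prefix \<omega> j)))"
  by (induction n) (simp_all add: partial_proj_snoc)

locale bounded_perturbation =
  fixes N :: nat and lam t :: "nat \<Rightarrow> real" and m T B :: real
  assumes lam: "\<And>i. i \<in> {1..N} \<Longrightarrow> 0 < lam i \<and> lam i \<le> m"
    and m: "0 < m" "m < 1"
    and t: "\<And>i. i \<in> {1..N} \<Longrightarrow> \<bar>t i\<bar> \<le> T"
    and N: "N \<ge> 1"
    and B: "B \<ge> 0"
begin

text \<open>
  The geometric series \<open>\<Sum> m\<^sup>j (T + B)\<close>, which bounds every admissible projection and, after scaling by \<open>m\<^sup>n\<close>,
  its tail from level \<open>n\<close> on.
\<close>

definition proj_bound :: real where "proj_bound = (T + B) / (1 - m)"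

definition admissible :: "(nat list \<Rightarrow> real) \<Rightarrow> bool" where
  "admissible \<theta> \<longleftrightarrow> (\<forall>u\<in>lists {1..N}. \<bar>\<theta> u\<bar> \<le> B)"

lemma proj_bound_nonneg: "proj_bound \<ge> 0"
  using B m t[of 1] N by (auto simp: proj_bound_def)

lemma summand_le:
  assumes "admissible \<theta>" "w \<in> lists {1..N}" "i \<in> {1..N}"
  shows "\<bar>word_ratio lam w * (t i + \<theta> w)\<bar> \<le> m ^ length w * (T + B)"
proof -
  have "\<bar>t i + \<theta> w\<bar> \<le> T + B"
    using t[of i] assms unfolding admissible_def by (smt (verit))
  moreover have "0 < word_ratio lam w" "word_ratio lam w \<le> m ^ length w"
    using word_ratio_pos[OF _ assms(2)] word_ratio_le_power[OF _ assms(2)] lam by blast+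
  ultimately show ?thesis
    by (auto simp: abs_mult intro!: mult_mono)
qed

lemma summand_prefix_le:
  assumes "admissible \<theta>" "\<omega> \<in> seqs N"
  shows "\<bar>word_ratio lam (seq_prefix \<omega> j) * (t (\<omega> j) + \<theta> (seq_prefix \<omega> j))\<bar> \<le> m ^ j * (T + B)"
  using summand_le[OF assms(1) seq_prefix_in_lists[OF assms(2), of j], of "\<omega> j"] assms(2)
  by (auto simp: seqs_def Pi_iff)

lemma tail_sums: "(\<lambda>j. m ^ (j + n) * (T + B)) sums (m ^ n * proj_bound)"
proof -
  have "(\<lambda>j. m ^ n * (T + B) * m ^ j) sums (m ^ n * (T + B) * (1 / (1 - m)))"
    using m by (intro sums_mult geometric_sums) auto
  then show ?thesis by (simp add: proj_bound_def power_add mult_ac)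
qed

lemma random_proj_approx:
  assumes "admissible \<theta>" "\<omega> \<in> seqs N"
  shows "\<bar>random_proj lam t \<theta> \<omega> - partial_proj lam t \<theta> (seq_prefix \<omega> n)\<bar> \<le> m ^ n * proj_bound"
proof -
  define a where "a j = word_ratio lam (seq_prefix \<omega> j) * (t (\<omega> j) + \<theta> (seq_prefix \<omega> j))" for j
  have le: "\<bar>a j\<bar> \<le> m ^ j * (T + B)" for j
    using summand_prefix_le[OF assms] by (simp add: a_def)
  have sumb: "summable (\<lambda>j. m ^ (j + n) * (T + B))" for n
    using tail_sums by (rule sums_summable)
  have suma: "summable a"
    by (rule summable_comparison_test'[OF sumb[of 0]]) (use le in simp)
  have "random_proj lam t \<theta> \<omega> = suminf a" "partial_proj lam t \<theta> (seq_prefix \<omega> n) = sum a {..<n}"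
    by (simp_all add: random_proj_def partial_proj_seq_prefix a_def[abs_def])
  then have "random_proj lam t \<theta> \<omega> - partial_proj lam t \<theta> (seq_prefix \<omega> n) = (\<Sum>j. a (j + n))"
    using suminf_split_initial_segment[OF suma, of n] by simp
  also have "\<bar>\<dots>\<bar> \<le> (\<Sum>j. m ^ (j + n) * (T + B))"
  proof -
    have abs_summable: "summable (\<lambda>j. \<bar>a (j + n)\<bar>)"
      by (rule summable_comparison_test'[OF sumb[of n]]) (use le in simp)
    show ?thesis
      by (rule order_trans[OF summable_rabs suminf_le]) (use abs_summable sumb le in auto)
  qed
  also have "\<dots> = m ^ n * proj_bound"
    using tail_sums by (rule sums_unique[symmetric])
  finally show ?thesis .
qed

lemma partial_proj_bounded:
  assumes "admissible \<theta>" "w \<in> lists {1..N}"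
  shows "\<bar>partial_proj lam t \<theta> w\<bar> \<le> proj_bound"
proof -
  have "\<bar>partial_proj lam t \<theta> w\<bar> \<le> (\<Sum>j<length w. \<bar>word_ratio lam (take j w) * (t (w ! j) + \<theta> (take j w))\<bar>)"
    unfolding partial_proj_def by (rule sum_abs)
  also have "\<dots> \<le> (\<Sum>j<length w. m ^ j * (T + B))"
  proof (rule sum_mono)
    fix j assume "j \<in> {..<length w}"
    then have "take j w \<in> lists {1..N}" "w ! j \<in> {1..N}" "length (take j w) = j"
      using assms(2) nth_mem[of j w] by (auto dest: in_set_takeD)
    then show "\<bar>word_ratio lam (take j w) * (t (w ! j) + \<theta> (take j w))\<bar> \<le> m ^ j * (T + B)"
      using summand_le[OF assms(1)] by metis
  qed
  also have "\<dots> \<le> (\<Sum>j. m ^ (j + 0) * (T + B))"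
    using tail_sums[of 0] m B t[of 1] N
    by (simp only: add_0_right) (intro sum_le_suminf, auto simp: sums_iff)
  also have "\<dots> = proj_bound"
    using tail_sums[of 0] by (simp add: sums_iff)
  finally show ?thesis .
qed

text \<open>
  A compactness argument along the tree: a point in the closure of the projection of a cylinder lies in
  the closure of the projection of one of its finitely many subcylinders. Following such choices
  produces a sequence whose projection is the given point.
\<close>

lemma closed_random_attractor:
  assumes "admissible \<theta>"
  shows "closed (random_attractor N lam t \<theta>)"
proof -
  define cyl where "cyl w = {\<omega> \<in> seqs N. seq_prefix \<omega> (length w) = w}" for w
  let ?\<Pi> = "random_proj lam t \<theta>"
  have split: "cyl w = (\<Union>i\<in>{1..N}. cyl (w @ [i]))" for w
    by (auto simp: cyl_def seqs_def Pi_iff)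
  have "y \<in> random_attractor N lam t \<theta>" if y: "y \<in> closure (random_attractor N lam t \<theta>)" for y
  proof -
    have "\<exists>f. \<forall>n. (length (f n) = n \<and> y \<in> closure (?\<Pi> ` cyl (f n))) \<and>
                 (\<exists>i\<in>{1..N}. f (Suc n) = f n @ [i])"
    proof (rule dependent_nat_choice)
      show "\<exists>w. length w = 0 \<and> y \<in> closure (?\<Pi> ` cyl w)"
        using y by (simp add: cyl_def random_attractor_def)
    next
      fix w n assume w: "length w = n \<and> y \<in> closure (?\<Pi> ` cyl w)"
      have "?\<Pi> ` cyl w \<subseteq> (\<Union>i\<in>{1..N}. closure (?\<Pi> ` cyl (w @ [i])))"
        unfolding split[of w] image_UN by (intro UN_mono closure_subset order_refl)
      then have "closure (?\<Pi> ` cyl w) \<subseteq> (\<Union>i\<in>{1..N}. closure (?\<Pi> ` cyl (w @ [i])))"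
        by (rule closure_minimal) (intro closed_UN finite_atLeastAtMost ballI closed_closure)
      with w obtain i where "i \<in> {1..N}" "y \<in> closure (?\<Pi> ` cyl (w @ [i]))"
        by auto
      then show "\<exists>v. (length v = Suc n \<and> y \<in> closure (?\<Pi> ` cyl v)) \<and> (\<exists>i\<in>{1..N}. v = w @ [i])"
        using w by (intro exI[of _ "w @ [i]"]) auto
    qed
    then obtain f where f: "\<And>n. length (f n) = n" "\<And>n. y \<in> closure (?\<Pi> ` cyl (f n))"
        "\<And>n. \<exists>i\<in>{1..N}. f (Suc n) = f n @ [i]"
      by blast
    define \<omega> where "\<omega> n = last (f (Suc n))" for n
    have \<omega>: "\<omega> \<in> seqs N"
      unfolding seqs_def
    proof
      fix n
      show "\<omega> n \<in> {1..N}"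
        using f(3)[of n] by (auto simp: \<omega>_def)
    qed
    have pre: "seq_prefix \<omega> n = f n" for n
    proof (induction n)
      case 0
      then show ?case using f(1)[of 0] by simp
    next
      case (Suc n)
      then show ?case using f(3)[of n] by (auto simp: \<omega>_def)
    qed
    have "dist (?\<Pi> \<omega>) y \<le> m ^ n * (2 * proj_bound)" for n
    proof -
      have "?\<Pi> ` cyl (f n) \<subseteq> cball (?\<Pi> \<omega>) (m ^ n * (2 * proj_bound))"
      proof
        fix x assume "x \<in> ?\<Pi> ` cyl (f n)"
        then obtain \<tau> where \<tau>: "\<tau> \<in> seqs N" "seq_prefix \<tau> n = f n" "x = ?\<Pi> \<tau>"
          by (auto simp: cyl_def f(1))
        show "x \<in> cball (?\<Pi> \<omega>) (m ^ n * (2 * proj_bound))"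
          using random_proj_approx[OF assms \<tau>(1), of n] random_proj_approx[OF assms \<omega>, of n] \<tau> pre[of n]
          by (auto simp: dist_real_def)
      qed
      then have "closure (?\<Pi> ` cyl (f n)) \<subseteq> cball (?\<Pi> \<omega>) (m ^ n * (2 * proj_bound))"
        by (rule closure_minimal) simp
      with f(2)[of n] show ?thesis by auto
    qed
    moreover have "(\<lambda>n. m ^ n * (2 * proj_bound)) \<longlonglongrightarrow> 0 * (2 * proj_bound)"
      using m by (intro tendsto_intros LIMSEQ_power_zero) auto
    ultimately have "dist (?\<Pi> \<omega>) y \<le> 0"
      by (intro LIMSEQ_le_const) auto
    then show ?thesis using \<omega> by (auto simp: random_attractor_def)
  qed
  then show ?thesis
    by (metis closure_subset_eq subsetI)
qed

lemma mem_random_attractor_if_approximable: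
  assumes \<theta>: "admissible \<theta>"
    and approx: "\<And>e. e > 0 \<Longrightarrow> \<exists>w\<in>lists {1..N}. m ^ length w \<le> e \<and> \<bar>y - partial_proj lam t \<theta> w\<bar> \<le> e"
  shows "y \<in> random_attractor N lam t \<theta>"
proof -
  have "y \<in> closure (random_attractor N lam t \<theta>)"
    unfolding closure_approachable
  proof (intro allI impI)
    fix e :: real assume "e > 0"
    then have "e / (proj_bound + 2) > 0"
      using proj_bound_nonneg by simp
    then obtain w where w: "w \<in> lists {1..N}" "m ^ length w \<le> e / (proj_bound + 2)"
        "\<bar>y - partial_proj lam t \<theta> w\<bar> \<le> e / (proj_bound + 2)"
      using approx by blast
    define \<omega> where "\<omega> i = (if i < length w then w ! i else 1)" for i
    have \<omega>: "\<omega> \<in> seqs N"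
      using w(1) N nth_mem[of _ w] by (auto simp: \<omega>_def seqs_def)
    have pre: "seq_prefix \<omega> (length w) = w"
      by (rule nth_equalityI) (auto simp: seq_prefix_def \<omega>_def)
    have "\<bar>random_proj lam t \<theta> \<omega> - partial_proj lam t \<theta> w\<bar> \<le> m ^ length w * proj_bound"
      using random_proj_approx[OF \<theta> \<omega>, of "length w"] pre by simp
    also have "\<dots> \<le> e / (proj_bound + 2) * proj_bound"
      using w proj_bound_nonneg by (intro mult_right_mono)
    finally have "dist (random_proj lam t \<theta> \<omega>) y \<le> e / (proj_bound + 2) * proj_bound + e / (proj_bound + 2)"
      using w(3) by (simp add: dist_real_def)
    also have "\<dots> = e * ((proj_bound + 1) / (proj_bound + 2))"
      by (simp add: distrib_left add_divide_distrib)
    also have "\<dots> < e"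
    proof -
      have "(proj_bound + 1) / (proj_bound + 2) < 1" using proj_bound_nonneg by simp
      from mult_strict_left_mono[OF this \<open>e > 0\<close>] show ?thesis by simp
    qed
    finally show "\<exists>x\<in>random_attractor N lam t \<theta>. dist x y < e"
      using \<omega> by (auto simp: random_attractor_def)
  qed
  then show ?thesis
    using closed_random_attractor[OF \<theta>] by simp
qed

end

section \<open>Independence of the subtrees\<close>

lemma measurable_partial_proj:
  assumes "\<And>j. j < length w \<Longrightarrow> take j w \<in> A" "sets \<mu> = sets borel"
  shows "(\<lambda>\<theta>. partial_proj lam t \<theta> w) \<in> borel_measurable (PiM A (\<lambda>_. \<mu>))"
proof -
  have "(\<lambda>\<theta>. \<theta> (take j w)) \<in> borel_measurable (PiM A (\<lambda>_. \<mu>))" if "j < length w" for j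
    using measurable_component_singleton[OF assms(1)[OF that], of "\<lambda>_. \<mu>"] assms(2)
    by (simp cong: measurable_cong_sets)
  then show ?thesis
    unfolding partial_proj_def
    by (intro borel_measurable_sum borel_measurable_times borel_measurable_add) auto
qed

locale perturbation_measure = bounded_perturbation N lam t m T B + prob_space \<mu>
  for N :: nat and lam t :: "nat \<Rightarrow> real" and m T B :: real and \<mu> :: "real measure" +
  assumes sets_\<mu>: "sets \<mu> = sets borel"
    and bounded_\<mu>: "AE x in \<mu>. \<bar>x\<bar> \<le> B"
begin

abbreviation P :: "(nat list \<Rightarrow> real) measure" where
  "P \<equiv> perturbation_law N \<mu>"

abbreviation L :: "nat list set" where
  "L \<equiv> lists {1..N}"

sublocale P: prob_space P
  unfolding perturbation_law_def by (rule prob_space_PiM) unfold_locales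

lemma measurable_partial_proj_P:
  assumes "w \<in> L"
  shows "(\<lambda>\<theta>. partial_proj lam t \<theta> w) \<in> borel_measurable P"
  unfolding perturbation_law_def
  by (rule measurable_partial_proj) (use assms sets_\<mu> in \<open>auto dest: in_set_takeD\<close>)

lemma AE_admissible: "AE \<theta> in P. admissible \<theta>"
proof -
  have "AE \<theta> in P. \<bar>\<theta> u\<bar> \<le> B" if "u \<in> L" for u
    unfolding perturbation_law_def
    by (rule AE_PiM_component[of L "\<lambda>_. \<mu>" u "\<lambda>x. \<bar>x\<bar> \<le> B"])
      (use that bounded_\<mu> prob_space_axioms in auto)
  moreover have "countable L"
    by (rule countable_lists) simp
  ultimately show ?thesis
    unfolding admissible_def by (simp add: AE_ball_countable)
qed

lemma marginal_P:
  assumes "A \<subseteq> L"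
  shows "distr P (PiM A (\<lambda>_. \<mu>)) (\<lambda>\<theta>. restrict \<theta> A) = PiM A (\<lambda>_. \<mu>)"
  unfolding perturbation_law_def
  using distr_PiM_reindex[of L "\<lambda>_. \<mu>" "\<lambda>x. x" A] prob_space_axioms assms
  by (auto simp: restrict_def[symmetric])

lemma indep_coordinates: "P.indep_vars (\<lambda>_. \<mu>) (\<lambda>u \<theta>. \<theta> u) L"
proof -
  have "[] \<in> L" by simp
  then have ne: "L \<noteq> {}" by blast
  have "distr P (PiM L (\<lambda>_. \<mu>)) (\<lambda>\<theta>. \<lambda>u\<in>L. \<theta> u) = PiM L (\<lambda>u. distr P \<mu> (\<lambda>\<theta>. \<theta> u))"
  proof -
    have "PiM L (\<lambda>_. \<mu>) = PiM L (\<lambda>u. distr P \<mu> (\<lambda>\<theta>. \<theta> u))"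
    proof (rule PiM_cong[OF refl])
      fix u assume "u \<in> L"
      then show "\<mu> = distr P \<mu> (\<lambda>\<theta>. \<theta> u)"
        unfolding perturbation_law_def
        by (rule distr_PiM_component[of L "\<lambda>_. \<mu>", symmetric, rotated]) (rule prob_space_axioms)
    qed
    with marginal_P[of L] show ?thesis by simp
  qed
  then show ?thesis
    by (subst P.indep_vars_iff_distr_eq_PiM'[OF ne])
      (auto simp: perturbation_law_def)
qed

text \<open>
  Fubini for the coordinates inside and outside \<open>A\<close>: the coordinates in \<open>A\<close> may be frozen while the
  others are integrated out.
\<close>

lemma nn_integral_split:
  assumes "A \<subseteq> L" and f: "f \<in> borel_measurable (PiM A (\<lambda>_. \<mu>) \<Otimes>\<^sub>M PiM (L - A) (\<lambda>_. \<mu>))"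
  shows "(\<integral>\<^sup>+\<theta>. f (restrict \<theta> A, restrict \<theta> (L - A)) \<partial>P)
       = (\<integral>\<^sup>+x. \<integral>\<^sup>+\<theta>. f (x, restrict \<theta> (L - A)) \<partial>P \<partial>PiM A (\<lambda>_. \<mu>))"
proof -
  let ?PA = "PiM A (\<lambda>_. \<mu>)" and ?PB = "PiM (L - A) (\<lambda>_. \<mu>)"
  interpret B: prob_space ?PB
    by (rule prob_space_PiM) unfold_locales
  have rA: "(\<lambda>\<theta>. restrict \<theta> A) \<in> measurable P ?PA"
    unfolding perturbation_law_def using assms(1) by (rule measurable_restrict_subset)
  have rB: "(\<lambda>\<theta>. restrict \<theta> (L - A)) \<in> measurable P ?PB"
    unfolding perturbation_law_def by (rule measurable_restrict_subset) simp
  have "P.indep_var ?PA (\<lambda>\<theta>. restrict (\<lambda>u. \<theta> u) A) ?PB (\<lambda>\<theta>. restrict (\<lambda>u. \<theta> u) (L - A))"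
    by (rule P.indep_var_restrict[OF indep_coordinates]) (use assms(1) in auto)
  then have joint: "?PA \<Otimes>\<^sub>M ?PB = distr P (?PA \<Otimes>\<^sub>M ?PB) (\<lambda>\<theta>. (restrict \<theta> A, restrict \<theta> (L - A)))"
    using marginal_P[OF assms(1)] marginal_P[of "L - A"] by (simp add: P.indep_var_distribution_eq)
  have "(\<integral>\<^sup>+\<theta>. f (restrict \<theta> A, restrict \<theta> (L - A)) \<partial>P)
      = (\<integral>\<^sup>+z. f z \<partial>distr P (?PA \<Otimes>\<^sub>M ?PB) (\<lambda>\<theta>. (restrict \<theta> A, restrict \<theta> (L - A))))"
    by (rule nn_integral_distr[symmetric]) (use rA rB f in auto)
  also have "\<dots> = (\<integral>\<^sup>+x. \<integral>\<^sup>+y. f (x, y) \<partial>?PB \<partial>?PA)"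
    unfolding joint[symmetric] by (rule B.nn_integral_fst[OF f, symmetric])
  also have "\<dots> = (\<integral>\<^sup>+x. \<integral>\<^sup>+y. f (x, y) \<partial>distr P ?PB (\<lambda>\<theta>. restrict \<theta> (L - A)) \<partial>?PA)"
    by (subst marginal_P) auto
  also have "\<dots> = (\<integral>\<^sup>+x. \<integral>\<^sup>+\<theta>. f (x, restrict \<theta> (L - A)) \<partial>P \<partial>?PA)"
    by (intro nn_integral_cong nn_integral_distr rB) (use f in measurable)
  finally show ?thesis .
qed

text \<open>
  The perturbations of the subtree at \<open>w\<close>, re-indexed by the full tree and made extensional so
  that the result is again a point of the product space.
\<close>

definition shift :: "nat list \<Rightarrow> (nat list \<Rightarrow> real) \<Rightarrow> nat list \<Rightarrow> real" where
  "shift w \<theta> = (\<lambda>u\<in>L. \<theta> (w @ u))"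

lemma measurable_shift:
  assumes "\<And>u. u \<in> L \<Longrightarrow> w @ u \<in> A"
  shows "shift w \<in> measurable (PiM A (\<lambda>_. \<mu>)) P"
  unfolding shift_def[abs_def] perturbation_law_def
  by (rule measurable_restrict) (use assms in \<open>auto intro: measurable_component_singleton\<close>)

lemma distr_shift:
  assumes "w \<in> L"
  shows "distr P P (shift w) = P"
  unfolding shift_def[abs_def] perturbation_law_def
  using assms prob_space_axioms by (intro distr_PiM_reindex) (auto simp: inj_on_def)

text \<open>
  Distinct words of equal length have disjoint subtrees, so the shifted families are
  independent, and each of them is distributed like the original family.
\<close>

lemma nn_integral_prod_shift:
  assumes W: "W \<subseteq> words N n"
    and H: "\<And>w. w \<in> W \<Longrightarrow> H w \<in> borel_measurable P"
  shows "(\<integral>\<^sup>+\<theta>. (\<Prod>w\<in>W. H w (shift w \<theta>)) \<partial>P) = (\<Prod>w\<in>W. \<integral>\<^sup>+\<theta>. H w \<theta> \<partial>P)"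
proof -
  have fin: "finite W"
    using W by (rule finite_subset) simp
  have WL: "w \<in> L" if "w \<in> W" for w
    using that W by (auto simp: words_def)
  let ?K = "\<lambda>w. (@) w ` L"
  have disj: "disjoint_family_on ?K W"
    unfolding disjoint_family_on_def
  proof (intro ballI impI equals0I)
    fix w v x assume wv: "w \<in> W" "v \<in> W" "w \<noteq> v" "x \<in> ?K w \<inter> ?K v"
    then obtain u u' where "w @ u = v @ u'" by auto
    moreover have "length w = length v"
      using wv W by (auto simp: words_def)
    ultimately show False using wv(3) by simp
  qed
  have "P.indep_vars (\<lambda>w. PiM (?K w) (\<lambda>_. \<mu>)) (\<lambda>w \<theta>. restrict (\<lambda>u. \<theta> u) (?K w)) W"
  proof (rule P.indep_vars_restrict[OF indep_coordinates _ disj])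
    show "?K w \<subseteq> L" if "w \<in> W" for w
      using WL[OF that] by (intro image_subsetI) (simp only: append_in_lists_conv simp_thms)
  qed
  then have "P.indep_vars (\<lambda>_. borel) (\<lambda>w \<theta>. H w (shift w (restrict (\<lambda>u. \<theta> u) (?K w)))) W"
    by (rule P.indep_vars_compose2) (intro measurable_compose[OF measurable_shift] H, auto)
  moreover have "shift w (restrict (\<lambda>u. \<theta> u) (?K w)) = shift w \<theta>" for w \<theta>
    by (auto simp: shift_def restrict_def)
  ultimately have "P.indep_vars (\<lambda>_. borel) (\<lambda>w \<theta>. H w (shift w \<theta>)) W"
    by simp
  from P.indep_vars_nn_integral[OF fin this]
  have "(\<integral>\<^sup>+\<theta>. (\<Prod>w\<in>W. H w (shift w \<theta>)) \<partial>P) = (\<Prod>w\<in>W. \<integral>\<^sup>+\<theta>. H w (shift w \<theta>) \<partial>P)"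
    by simp
  also have "\<dots> = (\<Prod>w\<in>W. \<integral>\<^sup>+\<theta>. H w \<theta> \<partial>P)"
  proof (rule prod.cong[OF refl])
    fix w assume w: "w \<in> W"
    have "(\<integral>\<^sup>+\<theta>. H w (shift w \<theta>) \<partial>P) = (\<integral>\<^sup>+\<theta>. H w \<theta> \<partial>distr P P (shift w))"
      using H[OF w] measurable_shift[of w L] WL[OF w]
      by (intro nn_integral_distr[symmetric]) (auto simp: perturbation_law_def)
    then show "(\<integral>\<^sup>+\<theta>. H w (shift w \<theta>) \<partial>P) = (\<integral>\<^sup>+\<theta>. H w \<theta> \<partial>P)"
      using distr_shift[OF WL[OF w]] by simp
  qed
  finally show ?thesis .
qed

text \<open>
  One generation of the branching process. The quantities \<open>Z w\<close> depend only on perturbations at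
  words shorter than \<open>n\<close>; conditionally on these, the factors are independent functions of the
  subtrees at the words of length \<open>n\<close>, and each has conditional mean at most 1.
\<close>

lemma nn_integral_branching_le_1:
  fixes H :: "real \<Rightarrow> (nat list \<Rightarrow> real) \<Rightarrow> ennreal"
  defines "A n \<equiv> {u \<in> L. length u < n}"
  assumes W: "W \<subseteq> words N n"
    and Z: "\<And>w. w \<in> W \<Longrightarrow> Z w \<in> borel_measurable (PiM (A n) (\<lambda>_. \<mu>))"
    and H: "(\<lambda>(z, \<theta>). H z \<theta>) \<in> borel_measurable (borel \<Otimes>\<^sub>M P)"
    and H1: "\<And>z. (\<integral>\<^sup>+\<theta>. H z \<theta> \<partial>P) \<le> 1"
  shows "(\<integral>\<^sup>+\<theta>. (\<Prod>w\<in>W. H (Z w (restrict \<theta> (A n))) (shift w \<theta>)) \<partial>P) \<le> 1"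
proof -
  let ?PA = "PiM (A n) (\<lambda>_. \<mu>)" and ?PB = "PiM (L - A n) (\<lambda>_. \<mu>)"
  define f where "f = (\<lambda>(x, y). \<Prod>w\<in>W. H (Z w x) (shift w y))"
  have AL: "A n \<subseteq> L"
    by (auto simp: A_def)
  have below: "w @ u \<in> L - A n" if "w \<in> W" "u \<in> L" for w u
    using that W by (auto simp: A_def words_def)
  have Hz: "H z \<in> borel_measurable P" for z
    using measurable_compose[OF measurable_Pair1' H, of z] by simp
  have [measurable]: "f \<in> borel_measurable (?PA \<Otimes>\<^sub>M ?PB)"
    unfolding f_def case_prod_beta
  proof (rule borel_measurable_prod_ennreal)
    fix w assume w: "w \<in> W"
    have "(\<lambda>x. (Z w (fst x), shift w (snd x))) \<in> measurable (?PA \<Otimes>\<^sub>M ?PB) (borel \<Otimes>\<^sub>M P)"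
      using Z[OF w] measurable_shift[OF below[OF w]]
      by (intro measurable_Pair measurable_compose[OF measurable_fst] measurable_compose[OF measurable_snd])
    from measurable_compose[OF this H]
    show "(\<lambda>x. H (Z w (fst x)) (shift w (snd x))) \<in> borel_measurable (?PA \<Otimes>\<^sub>M ?PB)"
      by simp
  qed
  have sh: "shift w (restrict \<theta> (L - A n)) = shift w \<theta>" if "w \<in> W" for w \<theta>
    using below[OF that] by (auto simp: shift_def restrict_def)
  interpret A: prob_space ?PA
    by (rule prob_space_PiM) unfold_locales
  have "(\<integral>\<^sup>+\<theta>. (\<Prod>w\<in>W. H (Z w (restrict \<theta> (A n))) (shift w \<theta>)) \<partial>P)
      = (\<integral>\<^sup>+\<theta>. f (restrict \<theta> (A n), restrict \<theta> (L - A n)) \<partial>P)"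
    unfolding f_def prod.case by (intro nn_integral_cong prod.cong refl) (simp only: sh)
  also have "\<dots> = (\<integral>\<^sup>+x. \<integral>\<^sup>+\<theta>. f (x, restrict \<theta> (L - A n)) \<partial>P \<partial>?PA)"
    by (rule nn_integral_split[OF AL]) measurable
  also have "\<dots> = (\<integral>\<^sup>+x. (\<Prod>w\<in>W. \<integral>\<^sup>+\<theta>. H (Z w x) \<theta> \<partial>P) \<partial>?PA)"
  proof (rule nn_integral_cong)
    fix x
    have "(\<integral>\<^sup>+\<theta>. f (x, restrict \<theta> (L - A n)) \<partial>P) = (\<integral>\<^sup>+\<theta>. (\<Prod>w\<in>W. H (Z w x) (shift w \<theta>)) \<partial>P)"
      unfolding f_def prod.case by (intro nn_integral_cong prod.cong refl) (simp only: sh)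
    also have "\<dots> = (\<Prod>w\<in>W. \<integral>\<^sup>+\<theta>. H (Z w x) \<theta> \<partial>P)"
      by (rule nn_integral_prod_shift[OF W Hz])
    finally show "(\<integral>\<^sup>+\<theta>. f (x, restrict \<theta> (L - A n)) \<partial>P) = (\<Prod>w\<in>W. \<integral>\<^sup>+\<theta>. H (Z w x) \<theta> \<partial>P)" .
  qed
  also have "\<dots> \<le> (\<integral>\<^sup>+x. 1 \<partial>?PA)"
    by (intro nn_integral_mono prod_le_1) (use H1 in auto)
  also have "\<dots> = 1"
    by (simp add: A.emeasure_space_1)
  finally show ?thesis .
qed

end

section \<open>A block with many expected children\<close>

lemma exists_large_fibre:
  assumes "finite V" "finite I" "f ` V \<subseteq> I" "I \<noteq> {}"
  shows "\<exists>i\<in>I. real (card V) / real (card I) \<le> real (card {v \<in> V. f v = i})"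
proof (rule ccontr)
  assume less: "\<not> ?thesis"
  have "real (card V) = (\<Sum>i\<in>I. real (card {v \<in> V. f v = i}))"
    using sum.group[OF assms(1,2,3), of "\<lambda>_. 1::real"] by simp
  also have "\<dots> < (\<Sum>i\<in>I. real (card V) / real (card I))"
    using less assms by (intro sum_strict_mono) auto
  finally show False
    using assms by simp
qed

context perturbation_measure
begin

text \<open>
  The root perturbation is overwritten by 0 rather than subtracted, which makes the independence of its value
  evident.
\<close>

definition subtree_part :: "(nat list \<Rightarrow> real) \<Rightarrow> nat list \<Rightarrow> real" where
  "subtree_part \<theta> w = partial_proj lam t (\<theta>([] := 0)) w"

lemma partial_proj_upd_root:
  assumes "w \<noteq> []"
  shows "partial_proj lam t (\<theta>([] := x)) w = x + subtree_part \<theta> w"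
proof -
  obtain n where n: "length w = Suc n" using assms by (cases w) auto
  have "take (Suc j) w \<noteq> []" for j using assms by simp
  then show ?thesis
    unfolding partial_proj_def subtree_part_def n by (simp add: sum.lessThan_Suc_shift del: sum.lessThan_Suc)
qed

lemma subtree_part_bounded:
  assumes "admissible \<theta>" "w \<in> L"
  shows "\<bar>subtree_part \<theta> w\<bar> \<le> proj_bound"
proof -
  have "admissible (\<theta>([] := 0))"
    using assms(1) B by (auto simp: admissible_def)
  then show ?thesis
    unfolding subtree_part_def using assms(2) by (rule partial_proj_bounded)
qed

lemma measurable_subtree_part:
  assumes "w \<in> L"
  shows "(\<lambda>\<theta>. subtree_part \<theta> w) \<in> borel_measurable P"
proof (cases "w = []")
  case False
  have "(\<lambda>\<theta>. \<theta> []) \<in> borel_measurable P"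
    unfolding perturbation_law_def
    using measurable_component_singleton[of "[]" L "\<lambda>_. \<mu>"] sets_\<mu> by (simp cong: measurable_cong_sets)
  then have "(\<lambda>\<theta>. partial_proj lam t \<theta> w - \<theta> []) \<in> borel_measurable P"
    using measurable_partial_proj_P[OF assms] by (rule borel_measurable_diff[rotated])
  moreover have "subtree_part \<theta> w = partial_proj lam t \<theta> w - \<theta> []" for \<theta>
    using partial_proj_upd_root[OF False, of \<theta> "\<theta> []"] by simp
  ultimately show ?thesis by simp
qed (simp add: subtree_part_def)

text \<open>
  Integrating first over the root perturbation, whose law has density at least \<open>c\<close> on \<open>[p, q]\<close>:
  whenever the rest of the sum lies in \<open>G\<close>, the total lands in a prescribed interval of length
  \<open>h\<close> with conditional probability at least \<open>c * h\<close>.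
\<close>

lemma root_smoothing:
  assumes dens: "\<And>a b. p \<le> a \<Longrightarrow> a \<le> b \<Longrightarrow> b \<le> q \<Longrightarrow> c * (b - a) \<le> prob {a<..b}"
    and c: "c \<ge> 0" and w: "w \<in> L" "w \<noteq> []" and h: "h \<ge> 0"
    and G: "G \<in> sets borel" "\<And>y. y \<in> G \<Longrightarrow> p \<le> a - y \<and> a - y + h \<le> q"
  shows "c * h * P.prob {\<theta> \<in> space P. subtree_part \<theta> w \<in> G}
           \<le> P.prob {\<theta> \<in> space P. a < partial_proj lam t \<theta> w \<and> partial_proj lam t \<theta> w \<le> a + h}"
proof -
  let ?E = "{\<theta> \<in> space P. a < partial_proj lam t \<theta> w \<and> partial_proj lam t \<theta> w \<le> a + h}"
  let ?F = "{\<theta> \<in> space P. subtree_part \<theta> w \<in> G}"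
  have [measurable]: "(\<lambda>\<theta>. partial_proj lam t \<theta> w) \<in> borel_measurable P"
      "(\<lambda>\<theta>. subtree_part \<theta> w) \<in> borel_measurable P"
    using w(1) by (rule measurable_partial_proj_P measurable_subtree_part)+
  have E: "?E \<in> sets P" and F: "?F \<in> sets P"
    using G(1) by measurable
  let ?R = "PiM (L - {[]}) (\<lambda>_. \<mu>)"
  let ?u = "\<lambda>(x, \<theta>). \<theta>([] := x)"
  interpret R: prob_space ?R
    by (rule prob_space_PiM) unfold_locales
  interpret pair_sigma_finite \<mu> ?R ..
  have ins: "insert [] (L - {[]}) = L" by auto
  have P: "P = distr (\<mu> \<Otimes>\<^sub>M ?R) P ?u"
    using distr_pair_PiM_eq_PiM[of "L - {[]}" "\<lambda>_. \<mu>" "[]"] prob_space_axioms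
    unfolding ins perturbation_law_def by simp
  have u: "?u \<in> measurable (\<mu> \<Otimes>\<^sub>M ?R) P"
    using measurable_compose[OF measurable_pair_swap' measurable_add_dim[of "[]" "L - {[]}" "\<lambda>_. \<mu>"]]
    unfolding ins perturbation_law_def by (simp add: case_prod_beta)
  have sect: "(\<lambda>x. (x, \<theta>)) -` (?u -` A \<inter> space (\<mu> \<Otimes>\<^sub>M ?R)) = {x. \<theta>([] := x) \<in> A}"
    if "\<theta> \<in> space ?R" for A \<theta>
    using that sets_eq_imp_space_eq[OF sets_\<mu>] by (auto simp: space_pair_measure)
  have meas: "(\<lambda>\<theta>. emeasure \<mu> {x. \<theta>([] := x) \<in> A}) \<in> borel_measurable ?R" if A: "A \<in> sets P" for A
    using measurable_emeasure_Pair2[OF measurable_sets[OF u A]]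
    by (rule measurable_cong[THEN iffD1, rotated]) (simp only: sect)
  have int: "emeasure P A = (\<integral>\<^sup>+\<theta>. emeasure \<mu> {x. \<theta>([] := x) \<in> A} \<partial>?R)" if A: "A \<in> sets P" for A
  proof -
    have "emeasure P A = emeasure (\<mu> \<Otimes>\<^sub>M ?R) (?u -` A \<inter> space (\<mu> \<Otimes>\<^sub>M ?R))"
      by (subst P) (rule emeasure_distr[OF u A])
    also have "\<dots> = (\<integral>\<^sup>+\<theta>. emeasure \<mu> ((\<lambda>x. (x, \<theta>)) -` (?u -` A \<inter> space (\<mu> \<Otimes>\<^sub>M ?R))) \<partial>?R)"
      by (rule emeasure_pair_measure_alt2[OF measurable_sets[OF u A]])
    also have "\<dots> = (\<integral>\<^sup>+\<theta>. emeasure \<mu> {x. \<theta>([] := x) \<in> A} \<partial>?R)"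
      by (intro nn_integral_cong arg_cong[where f = "emeasure \<mu>"] sect)
    finally show ?thesis .
  qed
  have sub: "subtree_part (\<theta>([] := x)) w = subtree_part \<theta> w" for \<theta> x
    by (simp add: subtree_part_def)
  have "ennreal (c * h) * emeasure P ?F = (\<integral>\<^sup>+\<theta>. ennreal (c * h) * emeasure \<mu> {x. \<theta>([] := x) \<in> ?F} \<partial>?R)"
    unfolding int[OF F] by (rule nn_integral_cmult[OF meas[OF F], symmetric])
  also have "\<dots> \<le> (\<integral>\<^sup>+\<theta>. emeasure \<mu> {x. \<theta>([] := x) \<in> ?E} \<partial>?R)"
  proof (rule nn_integral_mono)
    fix \<theta> assume \<theta>: "\<theta> \<in> space ?R"
    have sp: "\<theta>([] := x) \<in> space P" for x
      using \<theta> measurable_space[OF u, of "(x, \<theta>)"] sets_eq_imp_space_eq[OF sets_\<mu>]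
      by (simp add: space_pair_measure)
    show "ennreal (c * h) * emeasure \<mu> {x. \<theta>([] := x) \<in> ?F} \<le> emeasure \<mu> {x. \<theta>([] := x) \<in> ?E}"
    proof (cases "subtree_part \<theta> w \<in> G")
      case True
      let ?a = "a - subtree_part \<theta> w"
      have "c * h \<le> prob {?a<..?a + h}"
        using dens[of ?a "?a + h"] G(2)[OF True] h by simp
      then have "ennreal (c * h) \<le> emeasure \<mu> {?a<..?a + h}"
        by (simp add: emeasure_eq_measure)
      also have "{?a<..?a + h} = {x. \<theta>([] := x) \<in> ?E}"
        using sp by (auto simp: partial_proj_upd_root[OF w(2)])
      finally have le: "ennreal (c * h) \<le> emeasure \<mu> {x. \<theta>([] := x) \<in> ?E}" .
      have "ennreal (c * h) * emeasure \<mu> {x. \<theta>([] := x) \<in> ?F} \<le> ennreal (c * h) * 1"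
        by (intro mult_left_mono emeasure_le_1) simp
      with le show ?thesis by simp
    next
      case False
      then have empty: "{x. \<theta>([] := x) \<in> ?F} = {}" by (simp add: sub)
      show ?thesis unfolding empty by simp
    qed
  qed
  also have "\<dots> = emeasure P ?E"
    by (rule int[OF E, symmetric])
  finally show ?thesis
    using c h by (simp add: P.emeasure_eq_measure flip: ennreal_mult')
qed


lemma AE_pigeonhole:
  fixes I :: "'i set" and G :: "'i \<Rightarrow> (nat list \<Rightarrow> real) set"
  assumes I: "finite I" "\<And>i. i \<in> I \<Longrightarrow> G i \<in> sets P" and cover: "AE \<theta> in P. \<exists>i\<in>I. \<theta> \<in> G i"
  shows "\<exists>i\<in>I. 1 / real (card I) \<le> P.prob (G i)"
proof (rule ccontr)
  assume less: "\<not> ?thesis"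
  have "P.prob (\<Union>i\<in>I. G i) = 1"
    using I cover by (subst P.prob_eq_1) auto
  moreover have "P.prob (\<Union>i\<in>I. G i) \<le> (\<Sum>i\<in>I. P.prob (G i))"
    using I by (intro measure_UNION_le) auto
  moreover have "I \<noteq> {}"
    using calculation by auto
  moreover from this have "(\<Sum>i\<in>I. P.prob (G i)) < (\<Sum>i\<in>I. 1 / real (card I))"
    using less I by (intro sum_strict_mono) auto
  ultimately show False
    using I by simp
qed

text \<open>
  The bounded random variables \<open>subtree_part \<theta> v\<close> are localised by two pigeonhole steps: each
  lies with probability at least \<open>1 / Q\<close> in one of \<open>Q\<close> cells of length \<open>\<delta>\<close>, and at least \<open>card U / Q\<close>
  words of the block \<open>U\<close> share the same cell \<open>i\<close>. The centre \<open>x0\<close> is chosen such that subtracting this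
  cell from points near \<open>x0\<close> leads into the middle of the interval \<open>[p, q]\<close> on which root smoothing
  works. The number \<open>Q\<close> does not depend on the block, so \<open>card U * r\<close> can be taken large enough to
  compensate both losses.
\<close>

lemma supercritical_block:
  assumes dim: "(\<Sum>i=1..N. lam i powr s) = 1" and s: "s > 1"
    and c: "c > 0" and pq: "p < q"
    and dens: "\<And>a b. p \<le> a \<Longrightarrow> a \<le> b \<Longrightarrow> b \<le> q \<Longrightarrow> c * (b - a) \<le> prob {a<..b}"
  shows "\<exists>k V r x0 \<epsilon>. 0 < k \<and> V \<subseteq> words N k \<and> (\<forall>v\<in>V. word_ratio lam v = r) \<and>
           0 < r \<and> r < 1 \<and> 0 < \<epsilon> \<and> 4 \<le> real (card V) * r \<and>
           (\<forall>x. \<bar>x - x0\<bar> \<le> \<epsilon> \<longrightarrow>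
              6 \<le> (\<Sum>v\<in>V. P.prob {\<theta> \<in> space P. \<bar>x - partial_proj lam t \<theta> v - r * x0\<bar> \<le> r * \<epsilon> / 2}))"
proof -
  define \<delta> where "\<delta> = (q - p) / 4"
  define \<epsilon> where "\<epsilon> = \<delta> / 2"
  define Q where "Q = nat \<lceil>2 * proj_bound / \<delta>\<rceil> + 1"
  define y where "y i = - proj_bound + real i * \<delta>" for i
  define X where "X = \<bar>(p + q) / 2\<bar> + proj_bound + 3 * \<delta>"
  have \<delta>: "\<delta> > 0" and \<epsilon>: "\<epsilon> > 0"
    using pq by (simp_all add: \<delta>_def \<epsilon>_def)
  have Q: "Q > 0" "2 * proj_bound \<le> real Q * \<delta>" "real Q * \<delta> \<le> 2 * proj_bound + 2 * \<delta>"
  proof -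
    have "real (nat \<lceil>2 * proj_bound / \<delta>\<rceil>) = of_int \<lceil>2 * proj_bound / \<delta>\<rceil>"
      using proj_bound_nonneg \<delta> by simp
    then have "2 * proj_bound / \<delta> \<le> real Q" "real Q \<le> 2 * proj_bound / \<delta> + 2"
      unfolding Q_def by linarith+
    then show "2 * proj_bound \<le> real Q * \<delta>" "real Q * \<delta> \<le> 2 * proj_bound + 2 * \<delta>"
      using \<delta> by (simp_all add: field_simps)
  qed (simp add: Q_def)
  have X: "X > 0"
    using proj_bound_nonneg \<delta> abs_ge_zero[of "(p + q) / 2"] unfolding X_def by linarith
  \<comment> \<open>Restricting \<open>U\<close> to the words sharing a cell costs a factor \<open>Q\<close>: the first term still leaves 4
    for \<open>card V * r\<close>, the second one leaves 6 after multiplication by the lower bound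
    \<open>c * \<epsilon> / Q\<close> for the contribution of each word, relative to \<open>r\<close>.\<close>
  define K where "K = max (4 * real Q) (6 * (real Q)\<^sup>2 / (c * \<epsilon>))"
  obtain k U r where k: "0 < k" and U: "U \<subseteq> words N k" "\<forall>v\<in>U. word_ratio lam v = r"
    and r: "0 < r" "r < min 1 (\<delta> / (X + \<epsilon>))" and K: "K \<le> real (card U) * r"
  proof -
    have "0 < lam i \<and> lam i < 1" if "i \<in> {1..N}" for i
      using lam[OF that] m by auto
    moreover have "min 1 (\<delta> / (X + \<epsilon>)) > 0"
      using \<delta> X \<epsilon> by simp
    ultimately show thesis
      using that exists_many_words_of_equal_ratio[of N lam s "min 1 (\<delta> / (X + \<epsilon>))" K] dim s by blast
  qed
  have fin: "finite U"
    using U(1) by (rule finite_subset) simp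
  have UL: "v \<in> L" "v \<noteq> []" if "v \<in> U" for v
    using that U(1) k by (auto simp: words_def)
  define G where "G v i = {\<theta> \<in> space P. subtree_part \<theta> v \<in> {y i..y i + \<delta>}}" for v i
  have "\<exists>i\<in>{..<Q}. 1 / real (card {..<Q}) \<le> P.prob (G v i)" if v: "v \<in> U" for v
  proof (rule AE_pigeonhole)
    have [measurable]: "(\<lambda>\<theta>. subtree_part \<theta> v) \<in> borel_measurable P"
      using UL(1)[OF v] by (rule measurable_subtree_part)
    show "G v i \<in> sets P" for i
      unfolding G_def by measurable
    show "AE \<theta> in P. \<exists>i\<in>{..<Q}. \<theta> \<in> G v i"
      using AE_admissible AE_space
    proof eventually_elim
      case (elim \<theta>)
      define z where "z = (subtree_part \<theta> v + proj_bound) / \<delta>"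
      have bd: "\<bar>subtree_part \<theta> v\<bar> \<le> proj_bound"
        using elim(1) UL(1)[OF v] by (rule subtree_part_bounded)
      then have z: "0 \<le> z" "z \<le> 2 * proj_bound / \<delta>"
        using \<delta> by (auto simp: z_def divide_right_mono)
      define i where "i = nat \<lfloor>z\<rfloor>"
      have i: "real i \<le> z" "z \<le> real i + 1"
        using z(1) unfolding i_def by linarith+
      have "i < Q"
        using z \<delta> proj_bound_nonneg unfolding i_def Q_def by linarith
      moreover have "y i \<le> subtree_part \<theta> v" "subtree_part \<theta> v \<le> y i + \<delta>"
        using i \<delta> by (simp_all add: y_def z_def field_simps)
      ultimately show ?case
        using elim(2) by (auto simp: G_def)
    qed
  qed simp
  then obtain f where f: "\<And>v. v \<in> U \<Longrightarrow> f v \<in> {..<Q}" "\<And>v. v \<in> U \<Longrightarrow> 1 / real Q \<le> P.prob (G v (f v))"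
    by (metis card_lessThan)
  obtain i where i: "i < Q" "real (card U) / real Q \<le> real (card {v \<in> U. f v = i})"
    using exists_large_fibre[OF fin, of "{..<Q}" f] f(1) Q(1) by (auto simp: lessThan_empty_iff)
  define V where "V = {v \<in> U. f v = i}"
  define x0 where "x0 = (p + q) / 2 + y i + \<delta> / 2"
  have x0: "\<bar>x0\<bar> \<le> X"
  proof -
    have "real i * \<delta> \<le> real Q * \<delta>" "0 \<le> real i * \<delta>"
      using i(1) \<delta> by (auto intro!: mult_right_mono)
    then have "\<bar>y i + \<delta> / 2\<bar> \<le> proj_bound + 3 * \<delta>"
      using Q(3) \<delta> proj_bound_nonneg unfolding y_def by linarith
    then show ?thesis
      using Q(3) \<delta> proj_bound_nonneg unfolding X_def x0_def by linarith
  qed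
  have cardV: "4 \<le> real (card V) * r" "6 * real Q / (c * \<epsilon>) \<le> real (card V) * r"
  proof -
    have "K / real Q \<le> real (card U) * r / real Q"
      using K Q by (intro divide_right_mono) auto
    also have "\<dots> \<le> real (card V) * r"
      using mult_right_mono[OF i(2), of r] r by (simp add: V_def)
    finally have KQ: "K / real Q \<le> real (card V) * r" .
    have "4 \<le> K / real Q" "6 * real Q / (c * \<epsilon>) \<le> K / real Q"
      using Q c \<epsilon> by (auto simp: K_def field_simps power2_eq_square)
    with KQ show "4 \<le> real (card V) * r" "6 * real Q / (c * \<epsilon>) \<le> real (card V) * r"
      by linarith+
  qed
  have "6 \<le> (\<Sum>v\<in>V. P.prob {\<theta> \<in> space P. \<bar>x - partial_proj lam t \<theta> v - r * x0\<bar> \<le> r * \<epsilon> / 2})"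
    if x: "\<bar>x - x0\<bar> \<le> \<epsilon>" for x
  proof -
    define a where "a = x - r * x0 - r * \<epsilon> / 2"
    have "\<bar>r * x0\<bar> + r * \<epsilon> \<le> r * (X + \<epsilon>)"
      using x0 r by (simp add: abs_mult distrib_left)
    also have "\<dots> < \<delta>"
      using r X \<epsilon> by (simp add: field_simps)
    finally have small: "\<bar>r * x0\<bar> + r * \<epsilon> < \<delta>" .
    have each: "c * (r * \<epsilon>) * (1 / real Q)
        \<le> P.prob {\<theta> \<in> space P. \<bar>x - partial_proj lam t \<theta> v - r * x0\<bar> \<le> r * \<epsilon> / 2}" if v: "v \<in> V" for v
    proof -
      have vU: "v \<in> U" "f v = i" using v by (auto simp: V_def)
      have [measurable]: "(\<lambda>\<theta>. partial_proj lam t \<theta> v) \<in> borel_measurable P"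
        using UL(1)[OF vU(1)] by (rule measurable_partial_proj_P)
      have "c * (r * \<epsilon>) * (1 / real Q) \<le> c * (r * \<epsilon>) * P.prob (G v i)"
        using f(2)[OF vU(1)] vU(2) c r \<epsilon> by (intro mult_left_mono) auto
      also have "\<dots> \<le> P.prob {\<theta> \<in> space P. a < partial_proj lam t \<theta> v \<and> partial_proj lam t \<theta> v \<le> a + r * \<epsilon>}"
        unfolding G_def
      proof (rule root_smoothing[OF dens])
        fix z assume z: "z \<in> {y i..y i + \<delta>}"
        have ends: "p = (p + q) / 2 - 2 * \<delta>" "q = (p + q) / 2 + 2 * \<delta>"
          by (simp_all add: \<delta>_def field_simps)
        have pos: "r * \<epsilon> > 0" using r \<epsilon> by simp
        have "x \<le> x0 + \<delta> / 2" "x0 - \<delta> / 2 \<le> x"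
          using x unfolding \<epsilon>_def by linarith+
        moreover have "y i \<le> z" "z \<le> y i + \<delta>"
          using z by auto
        ultimately have xz: "(p + q) / 2 - \<delta> \<le> x - z" "x - z \<le> (p + q) / 2 + \<delta>"
          using x0_def by linarith+
        have "r * x0 + r * \<epsilon> / 2 \<le> \<delta>" "- (r * x0) + r * \<epsilon> / 2 \<le> \<delta>"
          using small pos by linarith+
        then have "(p + q) / 2 - 2 * \<delta> \<le> a - z" "a - z + r * \<epsilon> \<le> (p + q) / 2 + 2 * \<delta>"
          using xz unfolding a_def by linarith+
        then show "p \<le> a - z \<and> a - z + r * \<epsilon> \<le> q"
          using ends by simp
      qed (use c r \<epsilon> UL[OF vU(1)] in auto)
      also have "\<dots> \<le> P.prob {\<theta> \<in> space P. \<bar>x - partial_proj lam t \<theta> v - r * x0\<bar> \<le> r * \<epsilon> / 2}"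
      proof (rule P.finite_measure_mono)
        have "\<bar>x - z - r * x0\<bar> \<le> r * \<epsilon> / 2" if "a < z" "z \<le> a + r * \<epsilon>" for z
          using that unfolding a_def by linarith
        then show "{\<theta> \<in> space P. a < partial_proj lam t \<theta> v \<and> partial_proj lam t \<theta> v \<le> a + r * \<epsilon>}
            \<subseteq> {\<theta> \<in> space P. \<bar>x - partial_proj lam t \<theta> v - r * x0\<bar> \<le> r * \<epsilon> / 2}"
          by blast
      qed measurable
      finally show ?thesis .
    qed
    have "6 = 6 * real Q / (c * \<epsilon>) * (c * \<epsilon> * (1 / real Q))"
      using Q c \<epsilon> by simp
    also have "\<dots> \<le> real (card V) * r * (c * \<epsilon> * (1 / real Q))"
      using cardV(2) c \<epsilon> Q by (intro mult_right_mono) auto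
    also have "\<dots> = (\<Sum>v\<in>V. c * (r * \<epsilon>) * (1 / real Q))"
      by simp
    also have "\<dots> \<le> (\<Sum>v\<in>V. P.prob {\<theta> \<in> space P. \<bar>x - partial_proj lam t \<theta> v - r * x0\<bar> \<le> r * \<epsilon> / 2})"
      by (rule sum_mono) (rule each)
    finally show ?thesis .
  qed
  moreover have "V \<subseteq> words N k" "\<forall>v\<in>V. word_ratio lam v = r"
    using U by (auto simp: V_def)
  ultimately show ?thesis
    using k r \<epsilon> cardV(1) by (intro exI[of _ k] exI[of _ V] exI[of _ r] exI[of _ x0] exI[of _ \<epsilon>]) auto
qed

end

section \<open>Counting the words that hit a point\<close>

text \<open>
  The number 6 is twice the 3 that is needed for the exponential weight below, and 4 makes
  \<open>(card V * r)\<^sup>n\<close> exceed \<open>2\<^sup>n\<close> by an exponential factor.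
\<close>

locale supercritical_system = perturbation_measure N lam t m T B \<mu>
  for N :: nat and lam t :: "nat \<Rightarrow> real" and m T B :: real and \<mu> :: "real measure" +
  fixes k :: nat and V :: "nat list set" and r x0 \<epsilon> :: real
  assumes k: "0 < k" and V: "V \<subseteq> words N k" and ratio_V: "\<And>v. v \<in> V \<Longrightarrow> word_ratio lam v = r"
    and r: "0 < r" "r < 1" and \<epsilon>: "0 < \<epsilon>" and card_V: "4 \<le> real (card V) * r"
    and offspring: "\<And>x. \<bar>x - x0\<bar> \<le> \<epsilon> \<Longrightarrow>
       6 \<le> (\<Sum>v\<in>V. P.prob {\<theta> \<in> space P. \<bar>x - partial_proj lam t \<theta> v - r * x0\<bar> \<le> r * \<epsilon> / 2})"
begin

lemma card_V_pos: "card V > 0"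
  using card_V r by (cases "card V = 0") auto

fun block_words :: "nat \<Rightarrow> nat list set" where
  "block_words 0 = {[]}"
| "block_words (Suc n) = (\<lambda>(w, v). w @ v) ` (block_words n \<times> V)"

lemma block_words_subset: "block_words n \<subseteq> words N (n * k)"
proof (induction n)
  case (Suc n)
  have "w @ v \<in> words N (Suc n * k)" if "w \<in> block_words n" "v \<in> V" for w v
    using append_mem_words[of w N "n * k" v k] Suc V that by (auto simp: add.commute)
  then show ?case by auto
qed simp

lemma block_words_in_lists: "w \<in> block_words n \<Longrightarrow> w \<in> L"
  and length_block_words: "w \<in> block_words n \<Longrightarrow> length w = n * k"
  using block_words_subset[of n] by (auto simp: words_def)

lemma finite_block_words: "finite (block_words n)"
  using block_words_subset by (rule finite_subset) simp

lemma inj_append_block_words: "inj_on (\<lambda>(w, v). w @ v) (block_words n \<times> V)"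
proof (rule inj_onI, clarify)
  fix w v w' v' assume *: "w \<in> block_words n" "w' \<in> block_words n" "w @ v = w' @ v'"
  then have "length w = length w'"
    using length_block_words by metis
  with * show "w = w' \<and> v = v'" by simp
qed

lemma card_block_words: "card (block_words n) = card V ^ n"
  by (induction n) (simp_all add: card_image[OF inj_append_block_words] card_cartesian_product)

lemma word_ratio_block_words: "w \<in> block_words n \<Longrightarrow> word_ratio lam w = r ^ n"
  by (induction n arbitrary: w) (auto simp: word_ratio_append ratio_V)

text \<open>
  The radius parameter \<open>\<rho>\<close> is \<open>\<epsilon>\<close> or \<open>\<epsilon> / 2\<close>. Real-valued, since the count enters exponents.
\<close>

definition hits :: "nat \<Rightarrow> real \<Rightarrow> real \<Rightarrow> (nat list \<Rightarrow> real) \<Rightarrow> real" where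
  "hits n \<rho> y \<theta> =
     (\<Sum>w\<in>block_words n. of_bool (\<bar>y - partial_proj lam t \<theta> w - r ^ n * x0\<bar> \<le> r ^ n * \<rho>))"

text \<open>
  The number of children of a word in the coordinates in which that word has become the root:
  \<open>z\<close> is the position of the point relative to the word, rescaled.
\<close>

definition children :: "real \<Rightarrow> (nat list \<Rightarrow> real) \<Rightarrow> real" where
  "children z \<theta> = (\<Sum>v\<in>V. of_bool (\<bar>z - partial_proj lam t \<theta> v - r * x0\<bar> \<le> r * \<epsilon> / 2))"

lemma children_bounds: "0 \<le> children z \<theta>" "children z \<theta> \<le> card V"
proof -
  show "0 \<le> children z \<theta>"
    unfolding children_def by (rule sum_nonneg) simp
  have "children z \<theta> \<le> (\<Sum>v\<in>V. 1)"
    unfolding children_def by (rule sum_mono) simp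
  then show "children z \<theta> \<le> card V" by simp
qed

lemma measurable_hits: "hits n \<rho> y \<in> borel_measurable P"
proof -
  have [measurable]: "(\<lambda>\<theta>. partial_proj lam t \<theta> w) \<in> borel_measurable P" if "w \<in> block_words n" for w
    using block_words_in_lists[OF that] by (rule measurable_partial_proj_P)
  show ?thesis
    unfolding hits_def[abs_def] of_bool_def by (rule borel_measurable_sum) measurable
qed

lemma measurable_children: "(\<lambda>(z, \<theta>). children z \<theta>) \<in> borel_measurable (borel \<Otimes>\<^sub>M P)"
  unfolding children_def case_prod_beta of_bool_def
proof (rule borel_measurable_sum)
  fix v assume "v \<in> V"
  then have [measurable]: "(\<lambda>\<theta>. partial_proj lam t \<theta> v) \<in> borel_measurable P"
    using V by (intro measurable_partial_proj_P) (auto simp: words_def)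
  show "(\<lambda>p. if \<bar>fst p - partial_proj lam t (snd p) v - r * x0\<bar> \<le> r * \<epsilon> / 2 then 1 else 0)
          \<in> borel_measurable (borel \<Otimes>\<^sub>M P)"
    by measurable
qed

lemma hits_Suc:
  "hits (Suc n) (\<epsilon> / 2) y \<theta> =
     (\<Sum>w\<in>block_words n. children ((y - partial_proj lam t \<theta> w) / r ^ n) (shift w \<theta>))"
proof -
  have eq: "(\<bar>y - partial_proj lam t \<theta> (w @ v) - r ^ Suc n * x0\<bar> \<le> r ^ Suc n * (\<epsilon> / 2)) =
      (\<bar>(y - partial_proj lam t \<theta> w) / r ^ n - partial_proj lam t (shift w \<theta>) v - r * x0\<bar> \<le> r * \<epsilon> / 2)"
    if w: "w \<in> block_words n" and v: "v \<in> V" for w v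
  proof -
    have "partial_proj lam t (\<lambda>u. \<theta> (w @ u)) v = partial_proj lam t (shift w \<theta>) v"
      by (rule partial_proj_cong) (use V v in \<open>auto simp: shift_def words_def dest: in_set_takeD\<close>)
    then have "y - partial_proj lam t \<theta> (w @ v) - r ^ Suc n * x0 =
        r ^ n * ((y - partial_proj lam t \<theta> w) / r ^ n - partial_proj lam t (shift w \<theta>) v - r * x0)"
      using r by (simp add: partial_proj_append word_ratio_block_words[OF w] field_simps)
    then have "\<bar>y - partial_proj lam t \<theta> (w @ v) - r ^ Suc n * x0\<bar> =
        r ^ n * \<bar>(y - partial_proj lam t \<theta> w) / r ^ n - partial_proj lam t (shift w \<theta>) v - r * x0\<bar>"
      using r by (simp add: abs_mult)
    moreover have "r ^ Suc n * (\<epsilon> / 2) = r ^ n * (r * \<epsilon> / 2)"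
      by simp
    ultimately show ?thesis
      using r by (simp only: mult_le_cancel_left_pos zero_less_power)
  qed
  have "hits (Suc n) (\<epsilon> / 2) y \<theta> = (\<Sum>w\<in>block_words n. \<Sum>v\<in>V.
      of_bool (\<bar>y - partial_proj lam t \<theta> (w @ v) - r ^ Suc n * x0\<bar> \<le> r ^ Suc n * (\<epsilon> / 2)))"
    unfolding hits_def block_words.simps
    by (subst sum.reindex[OF inj_append_block_words]) (simp add: sum.cartesian_product case_prod_beta)
  also have "\<dots> = (\<Sum>w\<in>block_words n. children ((y - partial_proj lam t \<theta> w) / r ^ n) (shift w \<theta>))"
    unfolding children_def by (intro sum.cong refl arg_cong[where f = of_bool] eq)
  finally show ?thesis .
qed

lemma exp_neg_le: "exp (- x) \<le> 1 - x / 2" if "0 \<le> x" "x \<le> 1" for x :: real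
proof -
  have "exp (- x) \<le> 1 / (1 + x)"
    using exp_ge_add_one_self[of x] that by (simp add: exp_minus field_simps)
  also have "\<dots> \<le> 1 - x / 2"
    using that mult_left_mono[of x 1 x] by (simp add: field_simps)
  finally show ?thesis .
qed

text \<open>
  The exponential weight of one word in one generation. It rewards a hit by 3 and charges 1 for every child,
  divided by \<open>card V\<close> to keep the exponent of the children in \<open>[-1, 0]\<close>.
\<close>

definition weight :: "real \<Rightarrow> (nat list \<Rightarrow> real) \<Rightarrow> real" where
  "weight z \<theta> = exp ((3 * of_bool (\<bar>z - x0\<bar> \<le> \<epsilon>) - children z \<theta>) / card V)"

text \<open>
  On \<open>[0, 1]\<close> the function \<open>exp (- x)\<close> lies below \<open>1 - x / 2\<close>. In the case of a hit, a mean of at least 6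
  children thus bounds the expected weight by \<open>exp a * (1 - a) \<le> 1\<close> with \<open>a = 3 / card V\<close>.
\<close>

lemma nn_integral_weight_le_1: "(\<integral>\<^sup>+\<theta>. ennreal (weight z \<theta>) \<partial>P) \<le> 1"
proof (cases "\<bar>z - x0\<bar> \<le> \<epsilon>")
  case False
  then have "(\<integral>\<^sup>+\<theta>. ennreal (weight z \<theta>) \<partial>P) \<le> (\<integral>\<^sup>+\<theta>. 1 \<partial>P)"
    using children_bounds card_V_pos by (intro nn_integral_mono) (simp add: weight_def)
  then show ?thesis by (simp add: P.emeasure_space_1)
next
  case True
  let ?M = "real (card V)"
  let ?E = "\<lambda>v. {\<theta> \<in> space P. \<bar>z - partial_proj lam t \<theta> v - r * x0\<bar> \<le> r * \<epsilon> / 2}"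
  have M: "?M > 0" using card_V_pos by simp
  have E: "?E v \<in> sets P" if "v \<in> V" for v
  proof -
    have [measurable]: "(\<lambda>\<theta>. partial_proj lam t \<theta> v) \<in> borel_measurable P"
      using V that by (intro measurable_partial_proj_P) (auto simp: words_def)
    show ?thesis by measurable
  qed
  have ch: "children z \<theta> = (\<Sum>v\<in>V. indicator (?E v) \<theta>)" if "\<theta> \<in> space P" for \<theta>
    unfolding children_def by (intro sum.cong) (use that in \<open>auto simp: indicator_def\<close>)
  have intE: "integrable P (indicator (?E v) :: _ \<Rightarrow> real)" if "v \<in> V" for v
    using E[OF that] by (rule integrable_real_indicator) (simp add: P.emeasure_eq_measure)
  then have int: "integrable P (\<lambda>\<theta>. \<Sum>v\<in>V. indicator (?E v) \<theta> :: real)"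
    by (rule Bochner_Integration.integrable_sum)
  then have intc: "integrable P (children z)"
    by (rule Bochner_Integration.integrable_cong[THEN iffD2, rotated 2]) (simp_all add: ch)
  have "P.expectation (children z) = P.expectation (\<lambda>\<theta>. \<Sum>v\<in>V. indicator (?E v) \<theta>)"
    by (rule Bochner_Integration.integral_cong) (simp_all add: ch)
  also have "\<dots> = (\<Sum>v\<in>V. P.prob (?E v))"
  proof (subst Bochner_Integration.integral_sum[OF intE])
    show "(\<Sum>v\<in>V. P.expectation (indicator (?E v))) = (\<Sum>v\<in>V. P.prob (?E v))"
      using E by (intro sum.cong refl) simp
  qed
  finally have mean: "6 \<le> P.expectation (children z)"
    using offspring[OF True] by simp
  have pt: "weight z \<theta> \<le> exp (3 / ?M) * (1 - children z \<theta> / (2 * ?M))" for \<theta>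
  proof -
    have "weight z \<theta> = exp (3 / ?M) * exp (- (children z \<theta> / ?M))"
      using True by (simp add: weight_def diff_divide_distrib flip: exp_add)
    also have "\<dots> \<le> exp (3 / ?M) * (1 - children z \<theta> / ?M / 2)"
      using children_bounds[of z \<theta>] M by (intro mult_left_mono exp_neg_le) auto
    finally show ?thesis by (simp add: mult.commute)
  qed
  have nonneg: "0 \<le> exp (3 / ?M) * (1 - children z \<theta> / (2 * ?M))" for \<theta>
    by (rule order_trans[OF _ pt]) (simp add: weight_def)
  have "(\<integral>\<^sup>+\<theta>. ennreal (weight z \<theta>) \<partial>P) \<le> (\<integral>\<^sup>+\<theta>. ennreal (exp (3 / ?M) * (1 - children z \<theta> / (2 * ?M))) \<partial>P)"
    by (intro nn_integral_mono ennreal_leI pt)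
  also have "\<dots> = ennreal (P.expectation (\<lambda>\<theta>. exp (3 / ?M) * (1 - children z \<theta> / (2 * ?M))))"
    using intc by (intro nn_integral_eq_integral) (use nonneg in auto)
  also have "P.expectation (\<lambda>\<theta>. exp (3 / ?M) * (1 - children z \<theta> / (2 * ?M))) =
      exp (3 / ?M) * (1 - P.expectation (children z) / (2 * ?M))"
    using intc by (simp add: P.prob_space)
  also have "\<dots> \<le> exp (3 / ?M) * (1 - 3 / ?M)"
    using mean M by (intro mult_left_mono) (auto simp: field_simps)
  also have "\<dots> \<le> exp (3 / ?M) * exp (- (3 / ?M))"
    using exp_ge_add_one_self[of "- (3 / ?M)"] by (intro mult_left_mono) auto
  also have "\<dots> = 1"
    by (simp flip: exp_add)
  finally show ?thesis by (simp add: ennreal_leI)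
qed

lemma measurable_weight: "(\<lambda>(z, \<theta>). ennreal (weight z \<theta>)) \<in> borel_measurable (borel \<Otimes>\<^sub>M P)"
proof -
  have [measurable]: "(\<lambda>p. children (fst p) (snd p)) \<in> borel_measurable (borel \<Otimes>\<^sub>M P)"
    using measurable_children by (simp add: case_prod_beta)
  show ?thesis
    unfolding weight_def case_prod_beta of_bool_def by measurable
qed

text \<open>
  On the failure event, \<open>3 * hits n - hits (Suc n)\<close> is at least \<open>3 * 2\<^sup>n - 2 * 2\<^sup>n = 2\<^sup>n\<close>, so the
  product of all weights is at least \<open>exp (2\<^sup>n / card V)\<close>, while its mean is at most 1.
\<close>

lemma failure_probability:
  "P.prob {\<theta> \<in> space P. 2 ^ n \<le> hits n \<epsilon> y \<theta> \<and> hits (Suc n) (\<epsilon> / 2) y \<theta> < 2 ^ Suc n}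
     \<le> exp (- (2 ^ n / card V))" (is "P.prob ?F \<le> _")
proof -
  let ?M = "real (card V)"
  let ?A = "{u \<in> L. length u < n * k}"
  let ?Z = "\<lambda>w \<theta>. (y - partial_proj lam t \<theta> w) / r ^ n"
  have M: "?M > 0" using card_V_pos by simp
  have F: "?F \<in> sets P"
  proof -
    note [measurable] = measurable_hits
    show ?thesis by measurable
  qed
  have take_in: "take j w \<in> ?A" if "w \<in> block_words n" "j < length w" for j w
    using that block_words_subset[of n] by (auto simp: words_def dest: in_set_takeD)
  have Z: "?Z w \<in> borel_measurable (PiM ?A (\<lambda>_. \<mu>))" if "w \<in> block_words n" for w
    by (intro borel_measurable_divide borel_measurable_diff measurable_partial_proj take_in sets_\<mu>
        borel_measurable_const that)
  have res: "?Z w (restrict \<theta> ?A) = ?Z w \<theta>" if "w \<in> block_words n" for w \<theta>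
  proof -
    have "partial_proj lam t (restrict \<theta> ?A) w = partial_proj lam t \<theta> w"
      by (rule partial_proj_cong) (use take_in[OF that] in simp)
    then show ?thesis by simp
  qed
  have prod: "(\<Prod>w\<in>block_words n. ennreal (weight (?Z w \<theta>) (shift w \<theta>))) =
      ennreal (exp ((3 * hits n \<epsilon> y \<theta> - hits (Suc n) (\<epsilon> / 2) y \<theta>) / ?M))" for \<theta>
  proof -
    have "of_bool (\<bar>?Z w \<theta> - x0\<bar> \<le> \<epsilon>) =
        (of_bool (\<bar>y - partial_proj lam t \<theta> w - r ^ n * x0\<bar> \<le> r ^ n * \<epsilon>) :: real)" for w
    proof -
      have "y - partial_proj lam t \<theta> w - r ^ n * x0 = r ^ n * (?Z w \<theta> - x0)"
        using r by (simp add: field_simps)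
      then have "\<bar>y - partial_proj lam t \<theta> w - r ^ n * x0\<bar> = r ^ n * \<bar>?Z w \<theta> - x0\<bar>"
        using r by (simp add: abs_mult)
      then show ?thesis
        using r by (simp only: mult_le_cancel_left_pos zero_less_power)
    qed
    then have h: "hits n \<epsilon> y \<theta> = (\<Sum>w\<in>block_words n. of_bool (\<bar>?Z w \<theta> - x0\<bar> \<le> \<epsilon>))"
      by (simp add: hits_def)
    have "(\<Prod>w\<in>block_words n. ennreal (weight (?Z w \<theta>) (shift w \<theta>))) =
        ennreal (\<Prod>w\<in>block_words n. weight (?Z w \<theta>) (shift w \<theta>))"
      by (rule prod_ennreal) (simp add: weight_def)
    also have "(\<Prod>w\<in>block_words n. weight (?Z w \<theta>) (shift w \<theta>)) =
        exp (\<Sum>w\<in>block_words n. (3 * of_bool (\<bar>?Z w \<theta> - x0\<bar> \<le> \<epsilon>) - children (?Z w \<theta>) (shift w \<theta>)) / ?M)"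
      unfolding weight_def by (rule exp_sum[OF finite_block_words, symmetric])
    also have "(\<Sum>w\<in>block_words n. (3 * of_bool (\<bar>?Z w \<theta> - x0\<bar> \<le> \<epsilon>) - children (?Z w \<theta>) (shift w \<theta>)) / ?M) =
        (3 * hits n \<epsilon> y \<theta> - hits (Suc n) (\<epsilon> / 2) y \<theta>) / ?M"
      unfolding h hits_Suc by (simp only: sum_divide_distrib[symmetric] sum_subtractf sum_distrib_left)
    finally show ?thesis .
  qed
  have "ennreal (exp (2 ^ n / ?M)) * emeasure P ?F = (\<integral>\<^sup>+\<theta>. ennreal (exp (2 ^ n / ?M)) * indicator ?F \<theta> \<partial>P)"
    by (rule nn_integral_cmult_indicator[OF F, symmetric])
  also have "\<dots> \<le> (\<integral>\<^sup>+\<theta>. (\<Prod>w\<in>block_words n. ennreal (weight (?Z w (restrict \<theta> ?A)) (shift w \<theta>))) \<partial>P)"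
  proof (rule nn_integral_mono)
    fix \<theta>
    have "(\<Prod>w\<in>block_words n. ennreal (weight (?Z w (restrict \<theta> ?A)) (shift w \<theta>))) =
        (\<Prod>w\<in>block_words n. ennreal (weight (?Z w \<theta>) (shift w \<theta>)))"
      by (intro prod.cong refl) (simp only: res)
    moreover have "exp (2 ^ n / ?M) \<le> exp ((3 * hits n \<epsilon> y \<theta> - hits (Suc n) (\<epsilon> / 2) y \<theta>) / ?M)"
      if "\<theta> \<in> ?F"
      using that M by (auto intro!: divide_right_mono)
    ultimately show "ennreal (exp (2 ^ n / ?M)) * indicator ?F \<theta>
        \<le> (\<Prod>w\<in>block_words n. ennreal (weight (?Z w (restrict \<theta> ?A)) (shift w \<theta>)))"
      unfolding prod by (cases "\<theta> \<in> ?F") (simp_all add: ennreal_leI)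
  qed
  also have "\<dots> \<le> 1"
    by (rule nn_integral_branching_le_1[OF block_words_subset Z measurable_weight nn_integral_weight_le_1])
  finally have "exp (2 ^ n / ?M) * P.prob ?F \<le> 1"
    by (simp add: P.emeasure_eq_measure flip: ennreal_mult')
  then show ?thesis
    by (simp add: exp_minus field_simps)
qed

end

section \<open>From doubling counts to an interval\<close>

context supercritical_system
begin

text \<open>
  Half of the radius of the intervals of level \<open>Suc n\<close>: moving a point by this much turns a hit with
  half radius into a hit with full radius.
\<close>

definition mesh :: "nat \<Rightarrow> real" where
  "mesh n = r ^ Suc n * \<epsilon> / 2"

text \<open>
  For admissible perturbations, every point that is hit at some level with radius parameter at most
  \<open>\<epsilon>\<close> lies in \<open>[-radius, radius]\<close>.
\<close>

definition radius :: real where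
  "radius = proj_bound + \<bar>x0\<bar> + \<epsilon>"

lemma mesh_pos: "mesh n > 0"
  using r \<epsilon> by (simp add: mesh_def)

lemma radius_pos: "radius > 0"
  using proj_bound_nonneg \<epsilon> by (simp add: radius_def)

text \<open>
  Integers \<open>j\<close> stand for the points \<open>j * d\<close>; the range is rounded outwards so that no multiple of \<open>d\<close> in
  \<open>[-radius, radius]\<close> is missed.
\<close>

definition grid :: "real \<Rightarrow> int set" where
  "grid d = {- \<lceil>radius / d\<rceil>..\<lceil>radius / d\<rceil>}"

lemma card_grid_le: "d > 0 \<Longrightarrow> real (card (grid d)) \<le> 2 * radius / d + 3"
proof -
  assume d: "d > 0"
  have "0 < radius / d"
    using radius_pos d by simp
  then have pos: "\<lceil>radius / d\<rceil> \<ge> 0"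
    by linarith
  then have "real (card (grid d)) = 2 * of_int \<lceil>radius / d\<rceil> + 1"
    by (simp add: grid_def)
  also have "\<dots> \<le> 2 * (radius / d) + 3"
    by linarith
  finally show ?thesis by simp
qed

lemma mem_grid:
  assumes "\<bar>of_int j * d\<bar> \<le> radius" "d > 0"
  shows "j \<in> grid d"
proof -
  have "\<bar>of_int j :: real\<bar> \<le> radius / d"
    using assms by (simp add: abs_mult field_simps)
  then have "\<bar>of_int j :: real\<bar> \<le> of_int \<lceil>radius / d\<rceil>"
    using le_of_int_ceiling order_trans by blast
  then show ?thesis
    unfolding grid_def atLeastAtMost_iff by linarith
qed

definition failure :: "nat \<Rightarrow> real \<Rightarrow> (nat list \<Rightarrow> real) set" where
  "failure n y = {\<theta> \<in> space P. 2 ^ n \<le> hits n \<epsilon> y \<theta> \<and> hits (Suc n) (\<epsilon> / 2) y \<theta> < 2 ^ Suc n}"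

lemma failure_in_events: "failure n y \<in> sets P"
proof -
  note [measurable] = measurable_hits
  show ?thesis unfolding failure_def by measurable
qed

text \<open>
  The grid of level \<open>n\<close> has of order \<open>(1 / r)\<^sup>n\<close> points, which the doubly exponentially small failure
  probability outweighs; the first Borel--Cantelli lemma applies.
\<close>

lemma AE_eventually_no_failure:
  "AE \<theta> in P. \<exists>n0. \<forall>n\<ge>n0. \<forall>j\<in>grid (mesh n). \<theta> \<notin> failure n (of_int j * mesh n)"
proof -
  let ?M = "real (card V)"
  define A where "A n = (\<Union>j\<in>grid (mesh n). failure n (of_int j * mesh n))" for n
  have A[measurable]: "A n \<in> sets P" for n
    unfolding A_def grid_def using failure_in_events by auto
  have M: "?M > 0" using card_V_pos by simp
  define K where "K = 4 * radius / (r * \<epsilon>) + 3"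
  have K: "K > 0"
    using radius_pos r \<epsilon> by (simp add: K_def add_pos_pos)
  have grid_le: "real (card (grid (mesh n))) \<le> K * (1 / r) ^ n" for n
  proof -
    have "1 \<le> (1 / r) ^ n"
      using r by (intro one_le_power) simp
    then have "2 * radius / mesh n + 3 \<le> K * (1 / r) ^ n"
      using r \<epsilon> by (simp add: K_def mesh_def field_simps)
    with card_grid_le[OF mesh_pos, of n] show ?thesis by linarith
  qed
  have prob_le: "P.prob (A n) \<le> K * (1 / r) ^ n * exp (- (2 ^ n / ?M))" for n
  proof -
    have "P.prob (A n) \<le> (\<Sum>j\<in>grid (mesh n). P.prob (failure n (of_int j * mesh n)))"
      unfolding A_def by (rule measure_UNION_le) (auto simp: grid_def failure_in_events)
    also have "\<dots> \<le> (\<Sum>j\<in>grid (mesh n). exp (- (2 ^ n / ?M)))"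
      unfolding failure_def by (rule sum_mono) (rule failure_probability)
    also have "\<dots> \<le> K * (1 / r) ^ n * exp (- (2 ^ n / ?M))"
      using grid_le[of n] by (simp add: mult_right_mono)
    finally show ?thesis .
  qed
  have "(\<lambda>n. K * (2 / r) ^ n * exp (- (2 ^ n / ?M))) \<longlonglongrightarrow> 0"
    using r M K by real_asymp
  then have "\<forall>\<^sub>F n in sequentially. K * (2 / r) ^ n * exp (- (2 ^ n / ?M)) < 1"
    by (rule order_tendstoD) simp
  then have "\<forall>\<^sub>F n in sequentially. norm (P.prob (A n)) \<le> (1 / 2) ^ n"
  proof eventually_elim
    case (elim n)
    have "K * (1 / r) ^ n * exp (- (2 ^ n / ?M)) = (K * (2 / r) ^ n * exp (- (2 ^ n / ?M))) * (1 / 2) ^ n"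
      by (simp add: power_divide)
    also have "\<dots> \<le> 1 * (1 / 2) ^ n"
      using elim by (intro mult_right_mono) auto
    finally show ?case using prob_le[of n] by simp
  qed
  then have "summable (\<lambda>n. P.prob (A n))"
    by (rule summable_comparison_test_ev) (simp add: summable_geometric)
  then have "AE \<theta> in P. \<forall>\<^sub>F n in sequentially. \<theta> \<in> space P - A n"
    by (intro borel_cantelli_AE1) (auto simp: P.emeasure_eq_measure)
  then show ?thesis
    by eventually_elim (auto simp: eventually_sequentially A_def)
qed

lemma hits_le_of_close:
  assumes "\<bar>y - y'\<bar> \<le> r ^ n * \<epsilon> / 2"
  shows "hits n (\<epsilon> / 2) y \<theta> \<le> hits n \<epsilon> y' \<theta>"
  unfolding hits_def
proof (rule sum_mono)
  fix w
  have "\<bar>y' - partial_proj lam t \<theta> w - r ^ n * x0\<bar> \<le> r ^ n * \<epsilon>"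
    if "\<bar>y - partial_proj lam t \<theta> w - r ^ n * x0\<bar> \<le> r ^ n * (\<epsilon> / 2)"
    using that assms by linarith
  then show "of_bool (\<bar>y - partial_proj lam t \<theta> w - r ^ n * x0\<bar> \<le> r ^ n * (\<epsilon> / 2))
      \<le> (of_bool (\<bar>y' - partial_proj lam t \<theta> w - r ^ n * x0\<bar> \<le> r ^ n * \<epsilon>) :: real)"
    by auto
qed

lemma hits_pos_imp_close:
  assumes "0 < hits n \<rho> y \<theta>"
  shows "\<exists>w\<in>block_words n. \<bar>y - partial_proj lam t \<theta> w - r ^ n * x0\<bar> \<le> r ^ n * \<rho>"
proof (rule ccontr)
  assume "\<not> ?thesis"
  then have "hits n \<rho> y \<theta> = 0"
    by (simp add: hits_def)
  with assms show False by simp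
qed

lemma power_r_mult_le: "0 \<le> c \<Longrightarrow> r ^ n * c \<le> c"
  using r mult_right_mono[of "r ^ n" 1 c] by (simp add: power_le_one)

text \<open>
  The centres of the \<open>card V ^ n\<close> intervals of level \<open>n\<close> lie in \<open>[-radius, radius]\<close>, which splits into of
  order \<open>(1 / r)\<^sup>n\<close> cells whose length is half the radius of the intervals. As \<open>card V * r \<ge> 4\<close>, some cell
  contains at least \<open>2\<^sup>n\<close> centres, and its left end point is hit by all of the corresponding words.
\<close>

lemma many_hits_somewhere:
  assumes \<theta>: "admissible \<theta>" and n: "4 * radius / \<epsilon> + 3 \<le> 2 ^ n"
  shows "\<exists>y. 2 ^ n \<le> hits n (\<epsilon> / 2) y \<theta>"
proof -
  let ?M = "real (card V)"
  define d where "d = r ^ n * \<epsilon> / 2"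
  have d: "d > 0" using r \<epsilon> by (simp add: d_def)
  define c where "c w = partial_proj lam t \<theta> w + r ^ n * x0" for w
  define f where "f w = \<lfloor>c w / d\<rfloor>" for w
  have f: "f ` block_words n \<subseteq> grid d"
  proof
    fix j assume "j \<in> f ` block_words n"
    then obtain w where w: "w \<in> block_words n" "j = f w" by auto
    have "\<bar>r ^ n * x0\<bar> \<le> \<bar>x0\<bar>"
      using power_r_mult_le[of "\<bar>x0\<bar>" n] r by (simp add: abs_mult)
    then have "\<bar>c w\<bar> \<le> radius"
      using partial_proj_bounded[OF \<theta> block_words_in_lists[OF w(1)]] \<epsilon> by (simp add: c_def radius_def)
    then have "\<bar>c w / d\<bar> \<le> radius / d"
      using d by (simp add: divide_right_mono)
    then show "j \<in> grid d"
      unfolding grid_def w(2) f_def atLeastAtMost_iff by linarith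
  qed
  have fin: "finite (grid d)" and ne: "grid d \<noteq> {}"
  proof -
    show "finite (grid d)" by (simp add: grid_def)
    show "grid d \<noteq> {}"
      using radius_pos d mem_grid[of 0 d] by auto
  qed
  obtain j where j: "j \<in> grid d"
      "real (card (block_words n)) / real (card (grid d)) \<le> real (card {w \<in> block_words n. f w = j})"
    using exists_large_fibre[OF finite_block_words fin f ne] by blast
  have "2 ^ n * real (card (grid d)) \<le> 2 ^ n * (2 * radius / d + 3)"
    using card_grid_le[OF d] by (intro mult_left_mono) auto
  also have "2 * radius / d + 3 \<le> (4 * radius / \<epsilon> + 3) / r ^ n"
    using r \<epsilon> by (simp add: d_def field_simps power_le_one)
  also have "\<dots> \<le> 2 ^ n / r ^ n"
    using n r by (intro divide_right_mono) auto
  also have "2 ^ n * (2 ^ n / r ^ n) = (4 / r) ^ n"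
    by (simp add: power_divide flip: power_mult_distrib)
  also have "\<dots> \<le> ?M ^ n"
    using card_V r by (intro power_mono) (auto simp: field_simps)
  finally have "2 ^ n * real (card (grid d)) \<le> real (card (block_words n))"
    by (simp add: card_block_words)
  then have "2 ^ n \<le> real (card (block_words n)) / real (card (grid d))"
    using fin ne by (simp add: field_simps card_gt_0_iff)
  also note j(2)
  also have "real (card {w \<in> block_words n. f w = j}) = (\<Sum>w\<in>block_words n. of_bool (f w = j))"
    using finite_block_words by (simp add: sum_of_bool_eq Int_def)
  also have "\<dots> \<le> hits n (\<epsilon> / 2) (of_int j * d) \<theta>"
    unfolding hits_def
  proof (rule sum_mono)
    fix w
    have "\<bar>of_int j * d - partial_proj lam t \<theta> w - r ^ n * x0\<bar> \<le> r ^ n * (\<epsilon> / 2)" if "f w = j"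
    proof -
      have "of_int j \<le> c w / d" "c w / d \<le> of_int j + 1"
        using that unfolding f_def by linarith+
      then have "of_int j * d \<le> c w" "c w \<le> of_int j * d + d"
        using d by (simp_all add: field_simps)
      then show ?thesis
        unfolding c_def d_def by linarith
    qed
    then show "of_bool (f w = j)
        \<le> (of_bool (\<bar>of_int j * d - partial_proj lam t \<theta> w - r ^ n * x0\<bar> \<le> r ^ n * (\<epsilon> / 2)) :: real)"
      by auto
  qed
  finally show ?thesis by blast
qed

text \<open>
  Rounding down or rounding up stays inside the interval, since its length is at least \<open>2 * d\<close>.
\<close>

lemma multiple_in_interval:
  fixes a b d y :: real
  assumes d: "d > 0" and ab: "2 * d \<le> b - a" and y: "a \<le> y" "y \<le> b"
  shows "\<exists>j::int. a \<le> of_int j * d \<and> of_int j * d \<le> b \<and> \<bar>of_int j * d - y\<bar> \<le> d"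
proof -
  have fl: "of_int \<lfloor>y / d\<rfloor> * d \<le> y" "y \<le> of_int \<lfloor>y / d\<rfloor> * d + d"
    using d floor_divide_lower[OF d, of y] floor_divide_upper[OF d, of y] by (auto simp: distrib_right)
  show ?thesis
  proof (cases "a \<le> of_int \<lfloor>y / d\<rfloor> * d")
    case True
    with fl y d show ?thesis
      by (intro exI[of _ "\<lfloor>y / d\<rfloor>"]) auto
  next
    case False
    have "of_int (\<lfloor>y / d\<rfloor> + 1) * d = of_int \<lfloor>y / d\<rfloor> * d + d"
      by (simp add: distrib_right)
    with False fl y d ab show ?thesis
      by (intro exI[of _ "\<lfloor>y / d\<rfloor> + 1"]) auto
  qed
qed

text \<open>
  Induction over the levels: a point of \<open>[a, b]\<close> is close to a grid point of \<open>[a, b]\<close>, whose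
  count doubles for half radius, and these hits are hits for the original point with full radius.
\<close>

lemma hits_persist:
  assumes space: "\<theta> \<in> space P"
    and good: "\<And>n j. n \<ge> n0 \<Longrightarrow> j \<in> grid (mesh n) \<Longrightarrow> \<theta> \<notin> failure n (of_int j * mesh n)"
    and J: "- radius \<le> a" "b \<le> radius" "r ^ n0 * \<epsilon> \<le> b - a"
    and start: "\<And>y. a \<le> y \<Longrightarrow> y \<le> b \<Longrightarrow> 2 ^ n0 \<le> hits n0 \<epsilon> y \<theta>"
    and n: "n \<ge> n0" and y: "a \<le> y" "y \<le> b"
  shows "2 ^ n \<le> hits n \<epsilon> y \<theta>"
  using n y
proof (induction n arbitrary: y rule: dec_induct)
  case (step n)
  have "2 * mesh n \<le> r ^ n0 * \<epsilon>"
    using power_decreasing[of n0 "Suc n" r] step.hyps r \<epsilon> by (auto simp: mesh_def)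
  then obtain j :: int where j: "a \<le> of_int j * mesh n" "of_int j * mesh n \<le> b" "\<bar>of_int j * mesh n - y\<bar> \<le> mesh n"
    using multiple_in_interval[OF mesh_pos, of n b a y] J(3) step.prems by auto
  have "j \<in> grid (mesh n)"
    using j J by (intro mem_grid mesh_pos) auto
  then have "\<theta> \<notin> failure n (of_int j * mesh n)"
    using good step.hyps by auto
  moreover have "2 ^ n \<le> hits n \<epsilon> (of_int j * mesh n) \<theta>"
    using step.IH j by blast
  ultimately have "2 ^ Suc n \<le> hits (Suc n) (\<epsilon> / 2) (of_int j * mesh n) \<theta>"
    using space by (simp add: failure_def)
  also have "\<dots> \<le> hits (Suc n) \<epsilon> y \<theta>"
    using j(3) by (intro hits_le_of_close) (simp add: mesh_def)
  finally show ?case .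
qed (rule start)

text \<open>
  All points close to the heavily hit point of a large level have many hits at this and, by persistence, at
  every later level. Hence they are approximated by partial sums over ever longer words.
\<close>

lemma interval_in_attractor:
  assumes \<theta>: "admissible \<theta>" "\<theta> \<in> space P"
    and good: "\<And>n j. n \<ge> n1 \<Longrightarrow> j \<in> grid (mesh n) \<Longrightarrow> \<theta> \<notin> failure n (of_int j * mesh n)"
  shows "\<exists>a b. a < b \<and> {a<..<b} \<subseteq> random_attractor N lam t \<theta>"
proof -
  have "filterlim (\<lambda>n. 2 ^ n :: real) at_top sequentially"
    by real_asymp
  then have "\<forall>\<^sub>F n in sequentially. 4 * radius / \<epsilon> + 3 \<le> 2 ^ n \<and> n1 \<le> n"
    by (intro eventually_conj eventually_ge_at_top) (simp add: filterlim_at_top)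
  from eventually_happens'[OF sequentially_bot this]
  obtain n where n: "n \<ge> n1" "4 * radius / \<epsilon> + 3 \<le> 2 ^ n"
    by blast
  obtain y0 where y0: "2 ^ n \<le> hits n (\<epsilon> / 2) y0 \<theta>"
    using many_hits_somewhere[OF \<theta>(1) n(2)] by blast
  define d where "d = r ^ n * \<epsilon> / 2"
  have d: "d > 0" "d \<le> \<epsilon> / 2"
    using r \<epsilon> power_r_mult_le[of "\<epsilon> / 2" n] by (auto simp: d_def)
  have "\<bar>y0\<bar> \<le> proj_bound + \<bar>x0\<bar> + \<epsilon> / 2"
  proof -
    have "0 < hits n (\<epsilon> / 2) y0 \<theta>"
      by (rule less_le_trans[OF _ y0]) simp
    then obtain w where w: "w \<in> block_words n" "\<bar>y0 - partial_proj lam t \<theta> w - r ^ n * x0\<bar> \<le> r ^ n * (\<epsilon> / 2)"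
      using hits_pos_imp_close by blast
    have "\<bar>r ^ n * x0\<bar> \<le> \<bar>x0\<bar>"
      using power_r_mult_le[of "\<bar>x0\<bar>" n] r by (simp add: abs_mult)
    with w(2) power_r_mult_le[of "\<epsilon> / 2" n] partial_proj_bounded[OF \<theta>(1) block_words_in_lists[OF w(1)]] \<epsilon>
    show ?thesis by linarith
  qed
  then have bounds: "- radius \<le> y0 - d" "y0 + d \<le> radius"
    using d(2) unfolding radius_def by linarith+
  have many: "2 ^ n' \<le> hits n' \<epsilon> y \<theta>" if "n' \<ge> n" "y0 - d \<le> y" "y \<le> y0 + d" for n' y
  proof (rule hits_persist[OF \<theta>(2) _ bounds _ _ that])
    show "r ^ n * \<epsilon> \<le> y0 + d - (y0 - d)"
      by (simp add: d_def)
    show "2 ^ n \<le> hits n \<epsilon> y \<theta>" if "y0 - d \<le> y" "y \<le> y0 + d" for y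
    proof -
      have "\<bar>y0 - y\<bar> \<le> r ^ n * \<epsilon> / 2"
        using that unfolding d_def by linarith
      with y0 show ?thesis
        using hits_le_of_close order_trans by blast
    qed
  qed (use good n(1) in auto)
  have "y \<in> random_attractor N lam t \<theta>" if y: "y0 - d < y" "y < y0 + d" for y
  proof (rule mem_random_attractor_if_approximable[OF \<theta>(1)])
    fix e :: real assume "e > 0"
    have "(\<lambda>n. r ^ n * (\<bar>x0\<bar> + \<epsilon>)) \<longlonglongrightarrow> 0 * (\<bar>x0\<bar> + \<epsilon>)"
      using r by (intro tendsto_intros LIMSEQ_power_zero) auto
    moreover have "(\<lambda>n. (m ^ k) ^ n) \<longlonglongrightarrow> 0"
      using m k by (intro LIMSEQ_power_zero) (auto simp: power_less_one_iff)
    ultimately have "\<forall>\<^sub>F n' in sequentially. r ^ n' * (\<bar>x0\<bar> + \<epsilon>) < e \<and> (m ^ k) ^ n' < e \<and> n \<le> n'"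
      using \<open>e > 0\<close> by (intro eventually_conj order_tendstoD eventually_ge_at_top) auto
    from eventually_happens'[OF sequentially_bot this]
    obtain n' where n': "r ^ n' * (\<bar>x0\<bar> + \<epsilon>) < e" "(m ^ k) ^ n' < e" "n \<le> n'" by blast
    have "2 ^ n' \<le> hits n' \<epsilon> y \<theta>"
      using y by (intro many[OF n'(3)]) auto
    then have "0 < hits n' \<epsilon> y \<theta>"
      by (rule less_le_trans[rotated]) simp
    then obtain w where w: "w \<in> block_words n'" "\<bar>y - partial_proj lam t \<theta> w - r ^ n' * x0\<bar> \<le> r ^ n' * \<epsilon>"
      using hits_pos_imp_close by blast
    have "\<bar>r ^ n' * x0\<bar> = r ^ n' * \<bar>x0\<bar>"
      using r by (simp add: abs_mult)
    then have "\<bar>y - partial_proj lam t \<theta> w\<bar> \<le> r ^ n' * (\<bar>x0\<bar> + \<epsilon>)"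
      using w(2) unfolding distrib_left by linarith
    moreover have "m ^ length w \<le> e"
      using n'(2) by (simp add: length_block_words[OF w(1)] mult.commute flip: power_mult)
    ultimately show "\<exists>w\<in>lists {1..N}. m ^ length w \<le> e \<and> \<bar>y - partial_proj lam t \<theta> w\<bar> \<le> e"
      using n'(1) block_words_in_lists[OF w(1)] by (intro bexI[of _ w]) auto
  qed
  then show ?thesis
    using d(1) by (intro exI[of _ "y0 - d"] exI[of _ "y0 + d"]) auto
qed

lemma AE_interval_in_attractor:
  "AE \<theta> in P. \<exists>a b. a < b \<and> {a<..<b} \<subseteq> random_attractor N lam t \<theta>"
  using AE_eventually_no_failure AE_admissible AE_space
proof eventually_elim
  case (elim \<theta>)
  then obtain n1 where "\<And>n j. n \<ge> n1 \<Longrightarrow> j \<in> grid (mesh n) \<Longrightarrow> \<theta> \<notin> failure n (of_int j * mesh n)"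
    by blast
  with elim show ?case by (intro interval_in_attractor)
qed

end

section \<open>The random attractor contains an interval\<close>

theorem corollary1p2:
  fixes N :: nat and lam t :: "nat \<Rightarrow> real" and s C M :: real
    and S :: "'a measure" and \<Theta> :: "'a \<Rightarrow> real"
  assumes lam: "\<And>i. i \<in> {1..N} \<Longrightarrow> 0 < lam i \<and> lam i < 1"
    and similarity_dim: "(\<Sum>i=1..N. lam i powr s) = 1"
    and s_gt_1: "s > 1"
    and prob: "prob_space S"
    and rv: "\<Theta> \<in> borel_measurable S"
    and bdd: "\<exists>B. AE x in S. \<bar>\<Theta> x\<bar> \<le> B"
    and supp: "compactly_supported (distr S borel \<Theta>)"
    and ac: "absolutely_continuous lborel (distr S borel \<Theta>)"
    and C: "C > 0"
    and M: "M \<ge> s"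
    and decay: "\<And>x::real. cmod (char (distr S borel \<Theta>) x) \<le> C / (1 + \<bar>x\<bar>) powr M"
  shows "AE \<theta> in perturbation_law N (distr S borel \<Theta>).
           \<exists>a b. a < b \<and> {a<..<b} \<subseteq> random_attractor N lam t \<theta>"
proof -
  define \<mu> where "\<mu> = distr S borel \<Theta>"
  interpret S: prob_space S by (rule prob)
  interpret \<mu>: real_distribution \<mu>
    unfolding \<mu>_def using rv by (rule S.real_distribution_distr)
  \<comment> \<open>Absolute continuity excludes atoms, so the inversion formula holds at all end points.\<close>
  have "measure \<mu> {x} = 0" for x
  proof -
    have "{x} \<in> null_sets lborel" by (simp add: null_sets_def)
    then have "{x} \<in> null_sets \<mu>"
      using ac unfolding \<mu>_def absolutely_continuous_def by blast
    then show ?thesis by (simp add: null_sets_def measure_def)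
  qed
  then obtain c p q where dens: "0 < c" "p < q"
      "\<And>a b. p \<le> a \<Longrightarrow> a \<le> b \<Longrightarrow> b \<le> q \<Longrightarrow> c * (b - a) \<le> measure \<mu> {a<..b}"
    using \<mu>.density_bounded_below_on_interval[of M C] M s_gt_1 decay unfolding \<mu>_def by force
  obtain B where B: "AE x in S. \<bar>\<Theta> x\<bar> \<le> B"
    using bdd by blast
  have N: "N \<ge> 1"
    using similarity_dim by (cases "N = 0") auto
  define m where "m = Max (lam ` {1..N})"
  define T where "T = Max ((\<lambda>i. \<bar>t i\<bar>) ` {1..N})"
  interpret perturbation_measure N lam t m T "max B 0" \<mu>
  proof unfold_locales
    show "0 < lam i \<and> lam i \<le> m" if "i \<in> {1..N}" for i
      using that lam by (auto simp: m_def)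
    show "0 < m" "m < 1"
      using N lam by (auto simp: m_def Max_gr_iff)
    show "\<bar>t i\<bar> \<le> T" if "i \<in> {1..N}" for i
      using that by (auto simp: T_def)
    show "AE x in \<mu>. \<bar>x\<bar> \<le> max B 0"
      unfolding \<mu>_def using B rv by (subst AE_distr_iff) (auto elim: eventually_mono)
  qed (use N in \<open>auto simp: \<mu>_def\<close>)
  obtain k V r x0 \<epsilon> where "0 < k" "V \<subseteq> words N k" "\<forall>v\<in>V. word_ratio lam v = r" "0 < r" "r < 1"
      "0 < \<epsilon>" "4 \<le> real (card V) * r"
      "\<forall>x. \<bar>x - x0\<bar> \<le> \<epsilon> \<longrightarrow>
         6 \<le> (\<Sum>v\<in>V. P.prob {\<theta> \<in> space P. \<bar>x - partial_proj lam t \<theta> v - r * x0\<bar> \<le> r * \<epsilon> / 2})"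
    using supercritical_block[OF similarity_dim s_gt_1 dens] by blast
  then interpret supercritical_system N lam t m T "max B 0" \<mu> k V r x0 \<epsilon>
    by unfold_locales auto
  show ?thesis
    using AE_interval_in_attractor unfolding \<mu>_def .
qed

end
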